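(* Let $d\ge 1$ and let $p\in\mathbb{C}[z_1,\dots,z_d]$. Then \[ \|p(T)\|\le 1 \] for every $d$-tuple $T=(T_1,\dots,T_d)$ of commuting contractive operators on a Hilbert space if and only if for every $d$-tuple $M=(M_1,\dots,M_d)$ of commuting contractive nilpotent matrices we have \[ \|p(M)\|\le 1 . \]
   Context: Hilbert spaces are complex. A bounded operator $T$ is contractive if $\|T\|\le 1$ in operator norm. "Matrices" means operators on a finite-dimensional Hilbert space, i.e. $n\times n$ complex matrices acting on $\mathbb{C}^n$ with the Euclidean inner product, with $n$ arbitrary; $\|\cdot\|$ is the operator norm. A $d$-tuple is commuting (contractive, nilpotent) if its entries commute pairwise (are each contractive, nilpotent). For a commuting tuple $T$, $p(T)$ is obtained by substituting $T_j$ for $z_j$. *)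

theory Defs
  imports
    "HOL-Library.Poly_Mapping"
    "HOL-Library.Equipollence"
    "Jordan_Normal_Form.VS_Connect"
    "Jordan_Normal_Form.Conjugate"
begin

section \<open>Complex Hilbert spaces with explicit carriers\<close>

text \<open>
  The theorem quantifies over all Hilbert spaces inside a formula, so a Hilbert space is a record
  with a carrier set and not a type of some class. The inner product is linear in its first
  argument, in agreement with \<open>v \<bullet>c w\<close> on \<open>complex vec\<close>.
\<close>

record 'a cinner_space = "(complex, 'a) module" +
  cinner :: "'a \<Rightarrow> 'a \<Rightarrow> complex"

definition hnorm :: "('a, 'b) cinner_space_scheme \<Rightarrow> 'a \<Rightarrow> real" where
  "hnorm H x = sqrt (Re (cinner H x x))"

locale complex_inner_product_space = vectorspace class_ring H
  for H :: "('a, 'b) cinner_space_scheme" (structure) +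
  assumes cinner_add_left:
      "\<lbrakk>x \<in> carrier H; y \<in> carrier H; z \<in> carrier H\<rbrakk>
        \<Longrightarrow> cinner H (x \<oplus>\<^bsub>H\<^esub> y) z = cinner H x z + cinner H y z"
    and cinner_smult_left:
      "\<lbrakk>x \<in> carrier H; y \<in> carrier H\<rbrakk> \<Longrightarrow> cinner H (c \<odot>\<^bsub>H\<^esub> x) y = c * cinner H x y"
    and cinner_commute:
      "\<lbrakk>x \<in> carrier H; y \<in> carrier H\<rbrakk> \<Longrightarrow> cinner H x y = cnj (cinner H y x)"
    and cinner_nonneg: "x \<in> carrier H \<Longrightarrow> 0 \<le> Re (cinner H x x)"
    and cinner_eq_zero: "\<lbrakk>x \<in> carrier H; cinner H x x = 0\<rbrakk> \<Longrightarrow> x = \<zero>\<^bsub>H\<^esub>"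

locale complex_hilbert_space = complex_inner_product_space H
  for H :: "('a, 'b) cinner_space_scheme" (structure) +
  assumes complete:
    "\<lbrakk>\<And>n. s n \<in> carrier H;
      \<And>e. 0 < e \<Longrightarrow> \<exists>N::nat. \<forall>m\<ge>N. \<forall>n\<ge>N. hnorm H (s m \<ominus>\<^bsub>H\<^esub> s n) < e\<rbrakk>
      \<Longrightarrow> \<exists>x\<in>carrier H. (\<lambda>n. hnorm H (s n \<ominus>\<^bsub>H\<^esub> x)) \<longlonglongrightarrow> 0"

text \<open>
  A type that carries a nonzero complex Hilbert space has at least the cardinality of the
  continuum. Requiring this cardinality of the ambient type excludes only types whose Hilbert
  spaces are all zero.
\<close>

lemma (in complex_inner_product_space) complex_lepoll_carrier:
  assumes "x \<in> carrier H" "x \<noteq> \<zero>\<^bsub>H\<^esub>"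
  shows "(UNIV :: complex set) \<lesssim> carrier H"
proof -
  have "cinner H x x \<noteq> 0" using assms cinner_eq_zero by blast
  then have "inj (\<lambda>c. c \<odot>\<^bsub>H\<^esub> x)"
    using assms by (intro injI) (metis cinner_smult_left mult_right_cancel)
  moreover have "(\<lambda>c. c \<odot>\<^bsub>H\<^esub> x) ` UNIV \<subseteq> carrier H" using assms by auto
  ultimately show ?thesis unfolding lepoll_def by blast
qed

section \<open>Operators\<close>

text \<open>
  Operators are functions on the ambient type of which only the values on the carrier matter.
\<close>

definition bounded_operator :: "('a, 'b) cinner_space_scheme \<Rightarrow> ('a \<Rightarrow> 'a) \<Rightarrow> bool" where
  "bounded_operator H T \<longleftrightarrow>
     T \<in> LinearCombinations.module_hom class_ring H H \<and> (\<exists>C. \<forall>x\<in>carrier H. hnorm H (T x) \<le> C * hnorm H x)"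

text \<open>The supremum is meaningful for bounded operators only.\<close>

definition opnorm :: "('a, 'b) cinner_space_scheme \<Rightarrow> ('a \<Rightarrow> 'a) \<Rightarrow> real" where
  "opnorm H T = Sup {hnorm H (T x) | x. x \<in> carrier H \<and> hnorm H x \<le> 1}"

definition contractive :: "('a, 'b) cinner_space_scheme \<Rightarrow> ('a \<Rightarrow> 'a) \<Rightarrow> bool" where
  "contractive H T \<longleftrightarrow> bounded_operator H T \<and> opnorm H T \<le> 1"

definition commuting_contractive_tuple ::
    "('a, 'b) cinner_space_scheme \<Rightarrow> nat \<Rightarrow> (nat \<Rightarrow> 'a \<Rightarrow> 'a) \<Rightarrow> bool" where
  "commuting_contractive_tuple H d T \<longleftrightarrow>
     (\<forall>j<d. contractive H (T j)) \<and>
     (\<forall>i<d. \<forall>j<d. \<forall>x\<in>carrier H. T i (T j x) = T j (T i x))"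

section \<open>Polynomials in finitely many variables\<close>

text \<open>
  A polynomial maps monomials, given by their exponent vectors, to coefficients. The variables
  \<open>z_1, \<dots>, z_d\<close> are indexed by \<open>0, \<dots>, d - 1\<close>.
\<close>

definition polys_in :: "nat \<Rightarrow> ((nat \<Rightarrow>\<^sub>0 nat) \<Rightarrow>\<^sub>0 complex) set" where
  "polys_in d = {p. \<forall>m\<in>Poly_Mapping.keys p. Poly_Mapping.keys m \<subseteq> {..<d}}"

primrec op_monom :: "(nat \<Rightarrow> 'a \<Rightarrow> 'a) \<Rightarrow> (nat \<Rightarrow>\<^sub>0 nat) \<Rightarrow> nat \<Rightarrow> 'a \<Rightarrow> 'a" where
  "op_monom T m 0 = id"
| "op_monom T m (Suc k) = op_monom T m k \<circ> (T k ^^ Poly_Mapping.lookup m k)"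

definition op_poly ::
    "('a, 'b) cinner_space_scheme \<Rightarrow> nat \<Rightarrow> ((nat \<Rightarrow>\<^sub>0 nat) \<Rightarrow>\<^sub>0 complex) \<Rightarrow> (nat \<Rightarrow> 'a \<Rightarrow> 'a) \<Rightarrow> 'a \<Rightarrow> 'a"
  where "op_poly H d p T x =
     (\<Oplus>\<^bsub>H\<^esub>m\<in>Poly_Mapping.keys p. Poly_Mapping.lookup p m \<odot>\<^bsub>H\<^esub> op_monom T m d x)"

section \<open>Matrices\<close>

text \<open>\<open>\<complex>\<^sup>n\<close> with the Euclidean inner product; \<open>mult\<close> and \<open>one\<close> are unused fields.\<close>

definition euclidean_cspace :: "nat \<Rightarrow> complex vec cinner_space" where
  "euclidean_cspace n =
     \<lparr>carrier = carrier_vec n, mult = undefined, one = undefined, zero = 0\<^sub>v n, add = (+),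
      smult = (\<cdot>\<^sub>v), cinner = (\<lambda>v w. v \<bullet>c w)\<rparr>"

lemma cinner_euclidean: "v \<in> carrier_vec n \<Longrightarrow> w \<in> carrier_vec n \<Longrightarrow>
    cinner (euclidean_cspace n) v w = (\<Sum>i<n. v $ i * cnj (w $ i))"
  by (auto simp: euclidean_cspace_def scalar_prod_def atLeast0LessThan intro!: sum.cong)

lemma hnorm_euclidean: "v \<in> carrier_vec n \<Longrightarrow>
    hnorm (euclidean_cspace n) v = sqrt (\<Sum>i<n. (cmod (v $ i))\<^sup>2)"
  by (simp add: hnorm_def cinner_euclidean complex_norm_square[symmetric] del: of_real_power)

lemma vectorspace_euclidean: "vectorspace class_ring (euclidean_cspace n)"
proof -
  have "abelian_group (euclidean_cspace n)"
  proof (rule abelian_groupI)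
    fix x assume "x \<in> carrier (euclidean_cspace n)"
    then show "\<exists>y\<in>carrier (euclidean_cspace n). y \<oplus>\<^bsub>euclidean_cspace n\<^esub> x = \<zero>\<^bsub>euclidean_cspace n\<^esub>"
      by (intro bexI[of _ "- x"]) (auto simp: euclidean_cspace_def)
  qed (auto simp: euclidean_cspace_def assoc_add_vec[of _ n] intro: comm_add_vec)
  moreover have "cring (class_ring :: complex ring)"
    by (rule class_cring.is_cring)
  ultimately have "Module.module (class_ring :: complex ring) (euclidean_cspace n)"
    by (intro Module.moduleI)
      (auto simp: euclidean_cspace_def add_smult_distrib_vec smult_add_distrib_vec[of _ n]
        smult_smult_assoc)
  then show ?thesis
    by (intro vectorspace.intro) (auto intro: class_field.field_axioms class_field)
qed

lemma a_minus_euclidean: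
  assumes "v \<in> carrier_vec n" "w \<in> carrier_vec n"
  shows "v \<ominus>\<^bsub>euclidean_cspace n\<^esub> w = v - w"
proof -
  interpret E: vectorspace class_ring "euclidean_cspace n" by (rule vectorspace_euclidean)
  have "\<ominus>\<^bsub>euclidean_cspace n\<^esub> w = - w"
    by (rule E.minus_equality) (use assms in \<open>auto simp: euclidean_cspace_def\<close>)
  then show ?thesis
    using assms by (auto simp: a_minus_def euclidean_cspace_def)
qed

lemma complex_hilbert_space_euclidean: "complex_hilbert_space (euclidean_cspace n)"
proof -
  interpret E: vectorspace class_ring "euclidean_cspace n" by (rule vectorspace_euclidean)
  have car: "carrier (euclidean_cspace n) = carrier_vec n"
    by (simp add: euclidean_cspace_def)
  have ops: "x \<oplus>\<^bsub>euclidean_cspace n\<^esub> y = x + y" "c \<odot>\<^bsub>euclidean_cspace n\<^esub> x = c \<cdot>\<^sub>v x"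
    "\<zero>\<^bsub>euclidean_cspace n\<^esub> = 0\<^sub>v n" for x y c
    by (auto simp: euclidean_cspace_def)
  show ?thesis
  proof (unfold_locales, goal_cases)
    case (1 x y z)
    then show ?case
      by (simp add: car ops cinner_euclidean sum.distrib distrib_right)
  next
    case (2 x y c)
    then show ?case
      by (simp add: car ops cinner_euclidean sum_distrib_left mult.assoc)
  next
    case (3 x y)
    then show ?case
      by (simp add: car cinner_euclidean mult.commute)
  next
    case (4 x)
    then show ?case
      by (simp add: car cinner_euclidean complex_norm_square[symmetric] sum_nonneg del: of_real_power)
  next
    case (5 x)
    then have x: "x \<in> carrier_vec n" by (simp add: car)
    have "cinner (euclidean_cspace n) x x = of_real (\<Sum>i<n. (cmod (x $ i))\<^sup>2)"
      using x by (simp add: cinner_euclidean complex_norm_square[symmetric])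
    then have "(\<Sum>i<n. (cmod (x $ i))\<^sup>2) = 0"
      using 5 by (metis of_real_eq_0_iff)
    then have "\<forall>i<n. x $ i = 0"
      by (subst (asm) sum_nonneg_eq_0_iff) auto
    then show ?case
      using x by (auto simp: ops)
  next
    case (6 s)
    have s: "s k \<in> carrier_vec n" for k using 6(1) by (simp add: car)
    have le: "cmod (v $ i) \<le> hnorm (euclidean_cspace n) v" if "v \<in> carrier_vec n" "i < n" for v i
    proof -
      have "(cmod (v $ i))\<^sup>2 \<le> (\<Sum>i<n. (cmod (v $ i))\<^sup>2)"
        using that by (intro member_le_sum) auto
      then show ?thesis
        using that by (simp add: hnorm_euclidean real_le_rsqrt)
    qed
    have "\<exists>l. (\<lambda>k. s k $ i) \<longlonglongrightarrow> l" if i: "i < n" for i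
    proof -
      have "Cauchy (\<lambda>k. s k $ i)"
      proof (rule CauchyI)
        fix e :: real assume "0 < e"
        from 6(2)[OF this] obtain N where N: "\<forall>j\<ge>N. \<forall>k\<ge>N.
            hnorm (euclidean_cspace n) (s j \<ominus>\<^bsub>euclidean_cspace n\<^esub> s k) < e" by blast
        have "cmod (s j $ i - s k $ i) < e" if "j \<ge> N" "k \<ge> N" for j k
        proof -
          have "cmod ((s j - s k) $ i) \<le> hnorm (euclidean_cspace n) (s j - s k)"
            using s i by (intro le) auto
          also have "\<dots> < e"
            using N that s by (simp add: a_minus_euclidean)
          finally show ?thesis using s i carrier_vecD[OF s[of k]] by simp
        qed
        then show "\<exists>N. \<forall>j\<ge>N. \<forall>k\<ge>N. norm (s j $ i - s k $ i) < e" by blast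
      qed
      then show ?thesis using Cauchy_convergent convergent_def by blast
    qed
    then obtain l where l: "\<And>i. i < n \<Longrightarrow> (\<lambda>k. s k $ i) \<longlonglongrightarrow> l i" by metis
    define x where "x = vec n l"
    have x: "x \<in> carrier_vec n" by (simp add: x_def)
    have eq: "hnorm (euclidean_cspace n) (s k \<ominus>\<^bsub>euclidean_cspace n\<^esub> x)
        = sqrt (\<Sum>i<n. (cmod (s k $ i - l i))\<^sup>2)" for k
      using s[of k] x by (simp add: a_minus_euclidean hnorm_euclidean) (simp add: x_def)
    have "(\<lambda>k. sqrt (\<Sum>i<n. (cmod (s k $ i - l i))\<^sup>2)) \<longlonglongrightarrow> sqrt (\<Sum>i<n. (cmod (l i - l i))\<^sup>2)"
      using l by (intro tendsto_intros) auto
    then have "(\<lambda>k. hnorm (euclidean_cspace n) (s k \<ominus>\<^bsub>euclidean_cspace n\<^esub> x)) \<longlonglongrightarrow> 0"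
      unfolding eq by simp
    then show ?case using x car by blast
  qed
qed

definition mat_opnorm :: "complex mat \<Rightarrow> real" where
  "mat_opnorm A = opnorm (euclidean_cspace (dim_col A)) (\<lambda>v. A *\<^sub>v v)"

definition nilpotent_mat :: "complex mat \<Rightarrow> bool" where
  "nilpotent_mat A \<longleftrightarrow> (\<exists>k. A ^\<^sub>m k = 0\<^sub>m (dim_row A) (dim_row A))"

definition commuting_contractive_nilpotent_mats ::
    "nat \<Rightarrow> nat \<Rightarrow> (nat \<Rightarrow> complex mat) \<Rightarrow> bool" where
  "commuting_contractive_nilpotent_mats n d M \<longleftrightarrow>
     (\<forall>j<d. M j \<in> carrier_mat n n \<and> mat_opnorm (M j) \<le> 1 \<and> nilpotent_mat (M j)) \<and>
     (\<forall>i<d. \<forall>j<d. M i * M j = M j * M i)"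

primrec mat_monom :: "nat \<Rightarrow> (nat \<Rightarrow> complex mat) \<Rightarrow> (nat \<Rightarrow>\<^sub>0 nat) \<Rightarrow> nat \<Rightarrow> complex mat" where
  "mat_monom n M m 0 = 1\<^sub>m n"
| "mat_monom n M m (Suc k) = mat_monom n M m k * M k ^\<^sub>m Poly_Mapping.lookup m k"

definition mat_poly ::
    "nat \<Rightarrow> nat \<Rightarrow> ((nat \<Rightarrow>\<^sub>0 nat) \<Rightarrow>\<^sub>0 complex) \<Rightarrow> (nat \<Rightarrow> complex mat) \<Rightarrow> complex mat" where
  "mat_poly n d p M =
     (\<Oplus>\<^bsub>module_mat TYPE(complex) n n\<^esub>m\<in>Poly_Mapping.keys p.
        Poly_Mapping.lookup p m \<cdot>\<^sub>m mat_monom n M m d)"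

end

theory Submission
  imports Defs "HOL-Analysis.L2_Norm"
begin

text \<open>
  Let \<open>x\<close> be a vector and \<open>T\<close> a commuting contractive tuple. For \<open>N\<close> larger than the degree of \<open>p\<close>,
  the truncated multiplications \<open>Z_j\<close> by \<open>z_j\<close> on the polynomials of degree less than \<open>N\<close> commute and are
  nilpotent. Writing \<open>q_k\<close> for the part of \<open>q\<close> of degree at most \<open>k\<close>, they are contractive for the norm
  \<open>\<parallel>q\<parallel>\<^sup>2 = \<Sum>k<N. \<parallel>q_k(T) x\<parallel>\<^sup>2 + \<Sum>m. \<bar>coeff q m\<bar>\<^sup>2\<close>, because \<open>(z_j q)_k(T) = T_j q_{k-1}(T)\<close>; the last sum
  only makes the form definite. An orthonormal basis turns the \<open>Z_j\<close> into matrices, and the hypothesis on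
  matrices applied to \<open>p(Z) 1 = p\<close> gives \<open>(N - deg p) \<parallel>p(T) x\<parallel>\<^sup>2 \<le> N \<parallel>x\<parallel>\<^sup>2 + 1\<close>. Divide by \<open>N\<close> and let
  \<open>N\<close> tend to infinity. (The norm is that of the cyclic subspace generated by \<open>(x, \<dots>, x)\<close> under \<open>T_j \<otimes> S\<close>,
  with \<open>S\<close> the nilpotent shift on \<open>\<complex>\<^sup>N\<close>.) Conversely, \<open>\<complex>\<^sup>n\<close> can be copied into any type with at
  least continuum many elements.
\<close>

section \<open>Homomorphisms and operators\<close>

lemma module_hom_in_carrier:
  "f \<in> LinearCombinations.module_hom R M N \<Longrightarrow> x \<in> carrier M \<Longrightarrow> f x \<in> carrier N"
  by (auto simp: LinearCombinations.module_hom_def)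

lemma module_hom_class_smult:
  "f \<in> LinearCombinations.module_hom class_ring M N \<Longrightarrow> x \<in> carrier M
    \<Longrightarrow> f (c \<odot>\<^bsub>M\<^esub> x) = c \<odot>\<^bsub>N\<^esub> f x"
  by (simp add: LinearCombinations.module_hom_def)

lemma module_hom_classI:
  assumes "\<And>x. x \<in> carrier M \<Longrightarrow> f x \<in> carrier N"
    and "\<And>x y. x \<in> carrier M \<Longrightarrow> y \<in> carrier M \<Longrightarrow> f (x \<oplus>\<^bsub>M\<^esub> y) = f x \<oplus>\<^bsub>N\<^esub> f y"
    and "\<And>c x. x \<in> carrier M \<Longrightarrow> f (c \<odot>\<^bsub>M\<^esub> x) = c \<odot>\<^bsub>N\<^esub> f x"
  shows "f \<in> LinearCombinations.module_hom class_ring M N"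
  using assms by (auto simp: LinearCombinations.module_hom_def)

lemma module_hom_comp_class:
  assumes f: "f \<in> LinearCombinations.module_hom class_ring M N"
    and g: "g \<in> LinearCombinations.module_hom class_ring L M"
  shows "(\<lambda>x. f (g x)) \<in> LinearCombinations.module_hom class_ring L N"
  using f g by (auto simp: LinearCombinations.module_hom_def Pi_iff)

section \<open>Norms and operator norms\<close>

context complex_inner_product_space
begin

lemma cinner_smult_right:
  "\<lbrakk>x \<in> carrier H; y \<in> carrier H\<rbrakk> \<Longrightarrow> cinner H x (c \<odot>\<^bsub>H\<^esub> y) = cnj c * cinner H x y"
  by (metis cinner_commute cinner_smult_left complex_cnj_mult smult_closed UNIV_I partial_object.select_convs(1))

lemma cinner_self: "x \<in> carrier H \<Longrightarrow> cinner H x x = of_real ((hnorm H x)\<^sup>2)"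
  using arg_cong[OF cinner_commute[of x x], of Im] cinner_nonneg[of x]
  by (simp add: hnorm_def complex_eq_iff)

lemma hnorm_nonneg: "x \<in> carrier H \<Longrightarrow> 0 \<le> hnorm H x"
  using cinner_nonneg by (simp add: hnorm_def)

lemma hnorm_smult: "x \<in> carrier H \<Longrightarrow> hnorm H (c \<odot>\<^bsub>H\<^esub> x) = cmod c * hnorm H x"
proof -
  assume x: "x \<in> carrier H"
  have "cinner H (c \<odot>\<^bsub>H\<^esub> x) (c \<odot>\<^bsub>H\<^esub> x) = (c * cnj c) * cinner H x x"
    using x by (simp add: cinner_smult_left cinner_smult_right)
  also have "\<dots> = of_real ((cmod c * hnorm H x)\<^sup>2)"
    using x by (simp add: cinner_self complex_norm_square[symmetric] power_mult_distrib)
  finally have "Re (cinner H (c \<odot>\<^bsub>H\<^esub> x) (c \<odot>\<^bsub>H\<^esub> x)) = (cmod c * hnorm H x)\<^sup>2"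
    by (simp only: Re_complex_of_real)
  then show ?thesis using x hnorm_nonneg[OF x] by (simp add: hnorm_def)
qed

lemma hnorm_zero: "hnorm H \<zero>\<^bsub>H\<^esub> = 0"
  using hnorm_smult[of "\<zero>\<^bsub>H\<^esub>" 0] by (simp add: smult_r_null)

lemma opnorm_leI:
  assumes "\<And>x. x \<in> carrier H \<Longrightarrow> hnorm H (T x) \<le> hnorm H x"
  shows "opnorm H T \<le> 1"
  unfolding opnorm_def
proof (rule cSup_least)
  \<comment> \<open>The zero vector lies in the unit ball, so the supremum is not taken over the
    empty set.\<close>
  show "{hnorm H (T x) |x. x \<in> carrier H \<and> hnorm H x \<le> 1} \<noteq> {}"
    using hnorm_zero by (auto intro!: exI[of _ "\<zero>\<^bsub>H\<^esub>"])
qed (use assms in force)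

text \<open>Scaling to the unit sphere. Boundedness enters because \<open>Sup\<close> dominates the
  members of the set only when the set is bounded above.\<close>

lemma hnorm_le_opnorm:
  assumes T: "bounded_operator H T" and x: "x \<in> carrier H"
  shows "hnorm H (T x) \<le> opnorm H T * hnorm H x"
proof -
  obtain C where C: "\<And>y. y \<in> carrier H \<Longrightarrow> hnorm H (T y) \<le> C * hnorm H y"
    using T by (auto simp: bounded_operator_def)
  have Tc: "T y \<in> carrier H" if "y \<in> carrier H" for y
    using T that by (auto simp: bounded_operator_def LinearCombinations.module_hom_def)
  show ?thesis
  proof (cases "hnorm H x = 0")
    \<comment> \<open>A vector of norm zero cannot be normalised; here the bound with
      \<open>C\<close> already forces \<open>hnorm H (T x)\<close> to be at most zero.\<close>
    case True
    then show ?thesis using C[OF x] by simp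
  next
    case False
    define y where "y = complex_of_real (1 / hnorm H x) \<odot>\<^bsub>H\<^esub> x"
    have y: "y \<in> carrier H" "hnorm H y = 1"
      using x False hnorm_nonneg[OF x] by (auto simp: y_def hnorm_smult norm_divide)
    \<comment> \<open>The sign of \<open>C\<close> is not known, hence the absolute value.\<close>
    have "hnorm H (T z) \<le> \<bar>C\<bar>" if "z \<in> carrier H" "hnorm H z \<le> 1" for z
    proof -
      have "hnorm H (T z) \<le> \<bar>C\<bar> * hnorm H z"
        using C[OF that(1)] hnorm_nonneg[OF that(1)] by (smt (verit) mult_right_mono)
      also have "\<dots> \<le> \<bar>C\<bar>" using that(2) by (simp add: mult_left_le)
      finally show ?thesis .
    qed
    then have "bdd_above {hnorm H (T z) |z. z \<in> carrier H \<and> hnorm H z \<le> 1}"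
      by (intro bdd_aboveI[of _ "\<bar>C\<bar>"]) auto
    then have "hnorm H (T y) \<le> opnorm H T"
      unfolding opnorm_def using y by (intro cSup_upper) auto
    moreover have "T y = complex_of_real (1 / hnorm H x) \<odot>\<^bsub>H\<^esub> T x"
      unfolding y_def using T x by (simp add: bounded_operator_def module_hom_class_smult)
    ultimately show ?thesis
      using Tc[OF x] x False hnorm_nonneg[OF x] by (simp add: hnorm_smult norm_divide field_simps)
  qed
qed

lemma contractive_hnorm_le:
  assumes "contractive H T" "x \<in> carrier H"
  shows "hnorm H (T x) \<le> hnorm H x"
proof -
  have "hnorm H (T x) \<le> opnorm H T * hnorm H x"
    using assms by (intro hnorm_le_opnorm) (auto simp: contractive_def)
  also have "\<dots> \<le> 1 * hnorm H x"
    using assms hnorm_nonneg by (intro mult_right_mono) (auto simp: contractive_def)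
  finally show ?thesis by simp
qed

end

lemma module_hom_finsum:
  assumes M: "Module.module R M" and N: "Module.module R N" and f: "f \<in> LinearCombinations.module_hom R M N"
    and "finite A" "u \<in> A \<rightarrow> carrier M"
  shows "f (\<Oplus>\<^bsub>M\<^esub>i\<in>A. u i) = (\<Oplus>\<^bsub>N\<^esub>i\<in>A. f (u i))"
proof -
  interpret mod_hom R M N f
    using M N f by (simp add: mod_hom_def mod_hom_axioms_def)
  show ?thesis
    using assms(4,5)
  proof (induction A rule: finite_induct)
    case (insert a A)
    then show ?case
      by (simp add: Pi_iff)
  qed simp
qed

section \<open>Linear combinations of orthonormal vectors\<close>

context complex_inner_product_space
begin

lemma cinner_finsum_left:
  assumes "finite A" "u \<in> A \<rightarrow> carrier H" "y \<in> carrier H"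
  shows "cinner H (\<Oplus>\<^bsub>H\<^esub>i\<in>A. a i \<odot>\<^bsub>H\<^esub> u i) y = (\<Sum>i\<in>A. a i * cinner H (u i) y)"
  using assms
proof (induction A rule: finite_induct)
  case empty
  then show ?case using cinner_smult_left[of "\<zero>\<^bsub>H\<^esub>" y 0] by simp
next
  case (insert i A)
  then have "(\<Oplus>\<^bsub>H\<^esub>i\<in>A. a i \<odot>\<^bsub>H\<^esub> u i) \<in> carrier H"
    by (intro M.finsum_closed) auto
  with insert show ?case
    by (simp add: Pi_iff cinner_add_left cinner_smult_left)
qed

text \<open>Parseval's identity. It serves twice: for the change of basis to an orthonormal one, and
  for the truncated shifts, which map basis vectors to distinct basis vectors or to zero.\<close>

lemma hnorm_finsum_orthonormal:
  assumes A: "finite A" and u: "u \<in> A \<rightarrow> carrier H"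
    and on: "\<And>i j. i \<in> A \<Longrightarrow> j \<in> A \<Longrightarrow> cinner H (u i) (u j) = (if i = j then 1 else 0)"
  shows "hnorm H (\<Oplus>\<^bsub>H\<^esub>i\<in>A. a i \<odot>\<^bsub>H\<^esub> u i) = sqrt (\<Sum>i\<in>A. (cmod (a i))\<^sup>2)"
proof -
  define y where "y = (\<Oplus>\<^bsub>H\<^esub>i\<in>A. a i \<odot>\<^bsub>H\<^esub> u i)"
  have y: "y \<in> carrier H"
    unfolding y_def using u by (intro M.finsum_closed) auto
  have right: "cinner H (u i) y = cnj (a i)" if i: "i \<in> A" for i
  proof -
    have "cinner H y (u i) = (\<Sum>j\<in>A. a j * cinner H (u j) (u i))"
      unfolding y_def using A u i by (intro cinner_finsum_left) auto
    also have "\<dots> = (\<Sum>j\<in>A. if j = i then a j else 0)"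
      using i by (intro sum.cong) (auto simp: on)
    also have "\<dots> = a i" using A i by simp
    finally show ?thesis using cinner_commute[of "u i" y] u i y by auto
  qed
  have "cinner H y y = (\<Sum>i\<in>A. a i * cinner H (u i) y)"
    using cinner_finsum_left[OF A u y] by (simp add: y_def)
  also have "\<dots> = of_real (\<Sum>i\<in>A. (cmod (a i))\<^sup>2)"
    by (simp add: right complex_norm_square[symmetric])
  finally show ?thesis unfolding hnorm_def y_def[symmetric] by simp
qed

end

section \<open>Monomials and polynomials of operators under intertwining maps\<close>

lemma op_monom_closed:
  assumes "\<And>j. j < k \<Longrightarrow> T j \<in> carrier H \<rightarrow> carrier H" "x \<in> carrier H"
  shows "op_monom T m k x \<in> carrier H"
proof -
  have pow: "(T j ^^ i) y \<in> carrier H" if "j < k" "y \<in> carrier H" for i j y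
    using that assms(1)[of j] by (induction i) auto
  show ?thesis
    using assms(2) pow by (induction k arbitrary: x) auto
qed

lemma op_monom_intertwine:
  assumes "\<And>j x. j < k \<Longrightarrow> x \<in> carrier H \<Longrightarrow> T j x \<in> carrier H"
    and "\<And>j x. j < k \<Longrightarrow> x \<in> carrier H \<Longrightarrow> f (T j x) = S j (f x)" "x \<in> carrier H"
  shows "f (op_monom T m k x) = op_monom S m k (f x)"
proof -
  have pow: "(T j ^^ i) y \<in> carrier H \<and> f ((T j ^^ i) y) = (S j ^^ i) (f y)"
    if "j < k" "y \<in> carrier H" for i j y
    using that assms(1,2)[of j] by (induction i) auto
  show ?thesis
    using assms(3) pow by (induction k arbitrary: x) auto
qed

text \<open>A linear map that intertwines two tuples intertwines their monomials, and linearity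
  extends this to polynomials. This moves \<open>p\<close> both through a change of basis and from
  coordinate space to its copy in another type.\<close>

lemma op_poly_intertwine:
  assumes "Module.module class_ring H" "Module.module class_ring K"
    and f: "f \<in> LinearCombinations.module_hom class_ring H K"
    and T: "\<And>j x. j < d \<Longrightarrow> x \<in> carrier H \<Longrightarrow> T j x \<in> carrier H"
    and fT: "\<And>j x. j < d \<Longrightarrow> x \<in> carrier H \<Longrightarrow> f (T j x) = S j (f x)"
    and x: "x \<in> carrier H"
  shows "f (op_poly H d p T x) = op_poly K d p S (f x)"
proof -
  interpret H: Module.module class_ring H by fact
  interpret K: Module.module class_ring K by fact
  have mc: "op_monom T m d x \<in> carrier H" for m
    using T x by (intro op_monom_closed) auto
  have im: "f (op_monom T m d x) = op_monom S m d (f x)" for m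
    using T fT x by (rule op_monom_intertwine)
  have imc: "op_monom S m d (f x) \<in> carrier K" for m
    using module_hom_in_carrier[OF f mc] by (simp add: im)
  have "f (op_poly H d p T x) =
      (\<Oplus>\<^bsub>K\<^esub>m\<in>Poly_Mapping.keys p. f (Poly_Mapping.lookup p m \<odot>\<^bsub>H\<^esub> op_monom T m d x))"
    unfolding op_poly_def using mc
    by (intro module_hom_finsum[OF assms(1,2) f]) auto
  also have "\<dots> = op_poly K d p S (f x)"
    unfolding op_poly_def using mc imc
    by (intro K.M.finsum_cong') (auto simp: module_hom_class_smult[OF f] im)
  finally show ?thesis .
qed

section \<open>Matrices as operators on Euclidean space\<close>

lemma euclidean_cspace_sel [simp]:
  "carrier (euclidean_cspace n) = carrier_vec n"
  "\<zero>\<^bsub>euclidean_cspace n\<^esub> = 0\<^sub>v n"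
  "v \<oplus>\<^bsub>euclidean_cspace n\<^esub> w = v + w"
  "c \<odot>\<^bsub>euclidean_cspace n\<^esub> v = c \<cdot>\<^sub>v v"
  by (simp_all add: euclidean_cspace_def)

lemma module_euclidean: "Module.module class_ring (euclidean_cspace n)"
  using vectorspace_euclidean[of n] by (simp add: vectorspace_def)

lemma mult_mat_vec_module_hom:
  assumes "A \<in> carrier_mat m n"
  shows "(*\<^sub>v) A \<in> LinearCombinations.module_hom class_ring (euclidean_cspace n) (euclidean_cspace m)"
  using assms by (intro module_hom_classI) (auto simp: mult_add_distrib_mat_vec mult_mat_vec)

lemma finsum_euclidean_index:
  assumes "finite I" "u \<in> I \<rightarrow> carrier_vec n" "r < n"
  shows "(\<Oplus>\<^bsub>euclidean_cspace n\<^esub>i\<in>I. u i) $ r = (\<Sum>i\<in>I. u i $ r)"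
proof -
  interpret E: Module.module class_ring "euclidean_cspace n" by (rule module_euclidean)
  show ?thesis
    using assms(1,2)
  proof (induction I rule: finite_induct)
    case (insert i I)
    then have "(\<Oplus>\<^bsub>euclidean_cspace n\<^esub>i\<in>I. u i) \<in> carrier (euclidean_cspace n)"
      by (intro E.M.finsum_closed) auto
    with insert \<open>r < n\<close> show ?case by (auto simp: Pi_iff)
  qed (use \<open>r < n\<close> in simp)
qed

lemma vec_eq_finsum_unit_vec:
  assumes v: "v \<in> carrier_vec n"
  shows "v = (\<Oplus>\<^bsub>euclidean_cspace n\<^esub>i\<in>{..<n}. v $ i \<cdot>\<^sub>v unit_vec n i)"
proof -
  interpret E: Module.module class_ring "euclidean_cspace n" by (rule module_euclidean)
  have c: "(\<Oplus>\<^bsub>euclidean_cspace n\<^esub>i\<in>{..<n}. v $ i \<cdot>\<^sub>v unit_vec n i) \<in> carrier (euclidean_cspace n)"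
    by (intro E.M.finsum_closed) auto
  show ?thesis
  proof (rule eq_vecI)
    fix r assume "r < dim_vec (\<Oplus>\<^bsub>euclidean_cspace n\<^esub>i\<in>{..<n}. v $ i \<cdot>\<^sub>v unit_vec n i)"
    then have r: "r < n" using c by simp
    have "(\<Sum>i<n. (v $ i \<cdot>\<^sub>v unit_vec n i) $ r) = (\<Sum>i<n. if i = r then v $ i else 0)"
      using r by (intro sum.cong) auto
    then show "v $ r = (\<Oplus>\<^bsub>euclidean_cspace n\<^esub>i\<in>{..<n}. v $ i \<cdot>\<^sub>v unit_vec n i) $ r"
      using r by (subst finsum_euclidean_index) auto
  qed (use v c in simp)
qed

lemma module_hom_euclidean_expand:
  assumes H: "Module.module class_ring H"
    and f: "f \<in> LinearCombinations.module_hom class_ring (euclidean_cspace n) H"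
    and v: "v \<in> carrier_vec n"
  shows "f v = (\<Oplus>\<^bsub>H\<^esub>i\<in>{..<n}. v $ i \<odot>\<^bsub>H\<^esub> f (unit_vec n i))"
proof -
  interpret H: Module.module class_ring H by fact
  have "f v = f (\<Oplus>\<^bsub>euclidean_cspace n\<^esub>i\<in>{..<n}. v $ i \<cdot>\<^sub>v unit_vec n i)"
    using vec_eq_finsum_unit_vec[OF v] by simp
  also have "\<dots> = (\<Oplus>\<^bsub>H\<^esub>i\<in>{..<n}. f (v $ i \<cdot>\<^sub>v unit_vec n i))"
    by (rule module_hom_finsum[OF module_euclidean H f]) auto
  also have "\<dots> = (\<Oplus>\<^bsub>H\<^esub>i\<in>{..<n}. v $ i \<odot>\<^bsub>H\<^esub> f (unit_vec n i))"
    using module_hom_class_smult[OF f] module_hom_in_carrier[OF f]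
    by (intro H.M.finsum_cong') auto
  finally show ?thesis .
qed

text \<open>Reduces operator identities on the truncated polynomial space to a check on
  monomials.\<close>

lemma module_hom_euclidean_eqI:
  assumes H: "Module.module class_ring H"
    and f: "f \<in> LinearCombinations.module_hom class_ring (euclidean_cspace n) H"
    and g: "g \<in> LinearCombinations.module_hom class_ring (euclidean_cspace n) H"
    and eq: "\<And>i. i < n \<Longrightarrow> f (unit_vec n i) = g (unit_vec n i)"
    and v: "v \<in> carrier_vec n"
  shows "f v = g v"
proof -
  interpret H: Module.module class_ring H by fact
  show ?thesis
    unfolding module_hom_euclidean_expand[OF H f v] module_hom_euclidean_expand[OF H g v]
    using eq module_hom_in_carrier[OF g] by (intro H.M.finsum_cong') auto
qed

text \<open>Extension by linearity from the standard basis; it later supplies the evaluation maps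
  from polynomials to the Hilbert space.\<close>

lemma ex_module_hom_euclidean:
  assumes H: "Module.module class_ring H" and u: "\<And>i. i < n \<Longrightarrow> u i \<in> carrier H"
  shows "\<exists>f\<in>LinearCombinations.module_hom class_ring (euclidean_cspace n) H. \<forall>i<n. f (unit_vec n i) = u i"
proof
  interpret H: Module.module class_ring H by fact
  define f where "f v = (\<Oplus>\<^bsub>H\<^esub>i\<in>{..<n}. v $ i \<odot>\<^bsub>H\<^esub> u i)" for v :: "complex vec"
  have uc: "c i \<odot>\<^bsub>H\<^esub> u i \<in> carrier H" if "i < n" for i and c :: "nat \<Rightarrow> complex"
    using u[OF that] by simp
  show "f \<in> LinearCombinations.module_hom class_ring (euclidean_cspace n) H"
  proof (rule module_hom_classI)
    fix v w assume "v \<in> carrier (euclidean_cspace n)" "w \<in> carrier (euclidean_cspace n)"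
    then have vw: "v \<in> carrier_vec n" "w \<in> carrier_vec n" by simp_all
    have "f (v + w) = (\<Oplus>\<^bsub>H\<^esub>i\<in>{..<n}. v $ i \<odot>\<^bsub>H\<^esub> u i \<oplus>\<^bsub>H\<^esub> w $ i \<odot>\<^bsub>H\<^esub> u i)"
      unfolding f_def using vw uc u H.smult_l_distr
      by (intro H.M.finsum_cong') auto
    also have "\<dots> = f v \<oplus>\<^bsub>H\<^esub> f w"
      unfolding f_def using uc by (intro H.M.finsum_addf) auto
    finally show "f (v \<oplus>\<^bsub>euclidean_cspace n\<^esub> w) = f v \<oplus>\<^bsub>H\<^esub> f w" by simp
  next
    fix c v assume "v \<in> carrier (euclidean_cspace n)"
    then have v: "v \<in> carrier_vec n" by simp
    have "f (c \<cdot>\<^sub>v v) = (\<Oplus>\<^bsub>H\<^esub>i\<in>{..<n}. c \<odot>\<^bsub>H\<^esub> (v $ i \<odot>\<^bsub>H\<^esub> u i))"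
      unfolding f_def using v uc u H.smult_assoc1
      by (intro H.M.finsum_cong') auto
    also have "\<dots> = c \<odot>\<^bsub>H\<^esub> f v"
      unfolding f_def using uc by (subst H.finsum_smult_ldistr) auto
    finally show "f (c \<odot>\<^bsub>euclidean_cspace n\<^esub> v) = c \<odot>\<^bsub>H\<^esub> f v" by simp
  qed (use uc in \<open>auto simp: f_def\<close>)
  show "\<forall>i<n. f (unit_vec n i) = u i"
  proof (intro allI impI)
    fix i assume i: "i < n"
    have "f (unit_vec n i) = (\<Oplus>\<^bsub>H\<^esub>j\<in>{..<n}. if i = j then u j else \<zero>\<^bsub>H\<^esub>)"
      unfolding f_def using u i H.smult_one H.smult_l_null
      by (intro H.M.finsum_cong') auto
    also have "\<dots> = u i"
      using i u by (intro H.M.finsum_singleton) auto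
    finally show "f (unit_vec n i) = u i" .
  qed
qed

lemma eq_mat_on_unit_vecI:
  assumes A: "A \<in> carrier_mat n n" and B: "B \<in> carrier_mat n n"
    and eq: "\<And>i. i < n \<Longrightarrow> A *\<^sub>v unit_vec n i = B *\<^sub>v (unit_vec n i :: complex vec)"
  shows "A = B"
proof (rule eq_matI)
  fix i j assume "i < dim_row B" "j < dim_col B"
  then have ij: "i < n" "j < n" using B by auto
  have "C $$ (i, j) = (C *\<^sub>v unit_vec n j) $ i" if "C \<in> carrier_mat n n" for C :: "complex mat"
    using that ij by auto
  from this[OF A] this[OF B] eq[OF ij(2)] show "A $$ (i, j) = B $$ (i, j)" by simp
qed (use A B in auto)

section \<open>Boundedness of matrices and evaluation of matrix polynomials\<close>

lemma bounded_operator_mat: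
  assumes A: "A \<in> carrier_mat n n"
  shows "bounded_operator (euclidean_cspace n) ((*\<^sub>v) A)"
proof -
  interpret E: complex_hilbert_space "euclidean_cspace n" by (rule complex_hilbert_space_euclidean)
  have le: "cmod (v $ i) \<le> hnorm (euclidean_cspace n) v" if "v \<in> carrier_vec n" "i < n" for v i
  proof -
    have "(cmod (v $ i))\<^sup>2 \<le> (\<Sum>i<n. (cmod (v $ i))\<^sup>2)"
      using that by (intro member_le_sum) auto
    then show ?thesis
      using that by (simp add: hnorm_euclidean real_le_rsqrt)
  qed
  \<comment> \<open>A crude bound suffices, since only the finiteness of the constant matters: the
    Euclidean norm is at most the sum of the moduli of the coordinates, and each coordinate of
    \<open>v\<close> is at most the norm of \<open>v\<close>.\<close>
  define a where "a = (\<Sum>i<n. \<Sum>j<n. cmod (A $$ (i, j)))"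
  have "hnorm (euclidean_cspace n) (A *\<^sub>v v) \<le> a * hnorm (euclidean_cspace n) v"
    if v: "v \<in> carrier_vec n" for v
  proof -
    have "hnorm (euclidean_cspace n) (A *\<^sub>v v) = L2_set (\<lambda>i. cmod ((A *\<^sub>v v) $ i)) {..<n}"
      using A v by (simp add: hnorm_euclidean L2_set_def)
    also have "\<dots> \<le> (\<Sum>i<n. cmod ((A *\<^sub>v v) $ i))"
      by (intro L2_set_le_sum) auto
    also have "\<dots> \<le> (\<Sum>i<n. \<Sum>j<n. cmod (A $$ (i, j)) * hnorm (euclidean_cspace n) v)"
    proof (rule sum_mono)
      fix i assume i: "i \<in> {..<n}"
      have "(A *\<^sub>v v) $ i = (\<Sum>j<n. A $$ (i, j) * v $ j)"
        using A v i by (auto simp: scalar_prod_def atLeast0LessThan)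
      also have "cmod \<dots> \<le> (\<Sum>j<n. cmod (A $$ (i, j) * v $ j))"
        by (rule norm_sum)
      also have "\<dots> \<le> (\<Sum>j<n. cmod (A $$ (i, j)) * hnorm (euclidean_cspace n) v)"
        using le v by (intro sum_mono) (auto simp: norm_mult intro!: mult_left_mono)
      finally show "cmod ((A *\<^sub>v v) $ i) \<le> (\<Sum>j<n. cmod (A $$ (i, j)) * hnorm (euclidean_cspace n) v)" .
    qed
    also have "\<dots> = a * hnorm (euclidean_cspace n) v"
      by (simp add: a_def sum_distrib_right)
    finally show ?thesis .
  qed
  then show ?thesis
    using mult_mat_vec_module_hom[OF A] by (auto simp: bounded_operator_def)
qed

lemma contractive_mat_iff:
  assumes "A \<in> carrier_mat n n"
  shows "contractive (euclidean_cspace n) ((*\<^sub>v) A) \<longleftrightarrow> mat_opnorm A \<le> 1"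
  using assms bounded_operator_mat[OF assms] by (auto simp: contractive_def mat_opnorm_def)

lemma pow_mat_mult_vec:
  assumes A: "A \<in> carrier_mat n n" and v: "v \<in> carrier_vec n"
  shows "(A ^\<^sub>m k) *\<^sub>v v = (((*\<^sub>v) A) ^^ k) v"
  using v
proof (induction k arbitrary: v)
  case (Suc k)
  then show ?case
    using A assoc_mult_mat_vec[of "A ^\<^sub>m k" n n A n v] by (simp add: funpow_swap1)
qed (use A in simp)

lemma smult_mat_mult_vec:
  "A \<in> carrier_mat m n \<Longrightarrow> v \<in> carrier_vec n \<Longrightarrow> (c \<cdot>\<^sub>m A) *\<^sub>v v = c \<cdot>\<^sub>v (A *\<^sub>v v)"
  by (intro eq_vecI) (auto simp: smult_scalar_prod_distrib[of _ n])

lemma mat_monom_carrier: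
  assumes "\<And>j. j < k \<Longrightarrow> M j \<in> carrier_mat n n"
  shows "mat_monom n M m k \<in> carrier_mat n n"
  using assms by (induction k) auto

lemma mat_monom_mult_vec:
  assumes "\<And>j. j < k \<Longrightarrow> M j \<in> carrier_mat n n" and "v \<in> carrier_vec n"
  shows "mat_monom n M m k *\<^sub>v v = op_monom (\<lambda>j. (*\<^sub>v) (M j)) m k v"
  using assms
proof (induction k arbitrary: v)
  case (Suc k)
  have M: "M k \<in> carrier_mat n n" "mat_monom n M m k \<in> carrier_mat n n"
    using Suc.prems by (auto intro: mat_monom_carrier)
  have pc: "M k ^\<^sub>m i *\<^sub>v v \<in> carrier_vec n" for i
    using M Suc.prems by (auto intro!: mult_mat_vec_carrier)
  have "mat_monom n M m (Suc k) *\<^sub>v v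
      = mat_monom n M m k *\<^sub>v (M k ^\<^sub>m Poly_Mapping.lookup m k *\<^sub>v v)"
    using Suc.prems by (simp add: assoc_mult_mat_vec[OF M(2) pow_carrier_mat[OF M(1)]])
  also have "\<dots> = op_monom (\<lambda>j. (*\<^sub>v) (M j)) m k (M k ^\<^sub>m Poly_Mapping.lookup m k *\<^sub>v v)"
    using Suc.IH[OF _ pc] Suc.prems by simp
  finally show ?case
    using M(1) Suc.prems by (simp add: pow_mat_mult_vec)
qed simp

lemma
  assumes M: "\<And>j. j < d \<Longrightarrow> M j \<in> carrier_mat n n"
  shows mat_poly_carrier: "mat_poly n d p M \<in> carrier_mat n n"
    and mat_poly_mult_vec: "v \<in> carrier_vec n \<Longrightarrow>
      mat_poly n d p M *\<^sub>v v = op_poly (euclidean_cspace n) d p (\<lambda>j. (*\<^sub>v) (M j)) v"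
proof -
  interpret MM: vectorspace class_ring "module_mat TYPE(complex) n n"
    by (rule matrix_vs)
  interpret E: Module.module class_ring "euclidean_cspace n" by (rule module_euclidean)
  have c: "mat_monom n M m d \<in> carrier_mat n n" for m
    using M by (intro mat_monom_carrier)
  show "mat_poly n d p M \<in> carrier_mat n n"
    unfolding mat_poly_def using c MM.M.finsum_closed[of _ "Poly_Mapping.keys p"]
    by (auto simp: module_mat_simps)
  assume v: "v \<in> carrier_vec n"
  \<comment> \<open>Evaluation at the fixed vector \<open>v\<close> is linear in the matrix, so it
    can be moved inside the sum that defines \<open>mat_poly\<close>.\<close>
  have hom: "(\<lambda>A. A *\<^sub>v v) \<in> LinearCombinations.module_hom class_ring
      (module_mat TYPE(complex) n n) (euclidean_cspace n)"
    using v by (intro module_hom_classI)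
      (auto simp: module_mat_simps add_mult_distrib_mat_vec smult_mat_mult_vec)
  have "mat_poly n d p M *\<^sub>v v = (\<Oplus>\<^bsub>euclidean_cspace n\<^esub>m\<in>Poly_Mapping.keys p.
      (Poly_Mapping.lookup p m \<cdot>\<^sub>m mat_monom n M m d) *\<^sub>v v)"
    unfolding mat_poly_def using c
    by (intro module_hom_finsum[OF MM.module_axioms module_euclidean hom]) (auto simp: module_mat_simps)
  also have "\<dots> = op_poly (euclidean_cspace n) d p (\<lambda>j. (*\<^sub>v) (M j)) v"
    unfolding op_poly_def using c v M mat_monom_mult_vec[of d M n v, symmetric]
    by (intro E.M.finsum_cong')
      (auto simp: smult_mat_mult_vec[of _ n n] intro!: mult_mat_vec_carrier)
  finally show "mat_poly n d p M *\<^sub>v v = op_poly (euclidean_cspace n) d p (\<lambda>j. (*\<^sub>v) (M j)) v" .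
qed

section \<open>Orthonormal bases for inner products on coordinate space\<close>

abbreviation euclidean_form :: "nat \<Rightarrow> (complex vec \<Rightarrow> complex vec \<Rightarrow> complex) \<Rightarrow> complex vec cinner_space" where
  "euclidean_form n B \<equiv> (euclidean_cspace n)\<lparr>cinner := B\<rparr>"

lemma module_hom_euclidean_matrix:
  assumes f: "f \<in> LinearCombinations.module_hom class_ring (euclidean_cspace n) (euclidean_cspace n)"
  obtains A where "A \<in> carrier_mat n n" "\<And>v. v \<in> carrier_vec n \<Longrightarrow> f v = A *\<^sub>v v"
proof
  define A where "A = mat n n (\<lambda>(r, c). f (unit_vec n c) $ r)"
  show A: "A \<in> carrier_mat n n" by (simp add: A_def)
  have u: "f (unit_vec n i) = A *\<^sub>v unit_vec n i" if "i < n" for i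
    using that module_hom_in_carrier[OF f, of "unit_vec n i"]
    by (intro eq_vecI) (auto simp: A_def)
  show "f v = A *\<^sub>v v" if "v \<in> carrier_vec n" for v
    by (rule module_hom_euclidean_eqI[OF module_euclidean f mult_mat_vec_module_hom[OF A] u that])
qed

lemma invertible_if_inj:
  assumes A: "(A :: complex mat) \<in> carrier_mat n n"
    and inj: "\<And>v. v \<in> carrier_vec n \<Longrightarrow> A *\<^sub>v v = 0\<^sub>v n \<Longrightarrow> v = 0\<^sub>v n"
  obtains B where "B \<in> carrier_mat n n" "A * B = 1\<^sub>m n" "B * A = 1\<^sub>m n"
proof -
  have "det A \<noteq> 0" using inj by (subst det_0_iff_vec_prod_zero[OF A]) auto
  from det_non_zero_imp_unit[OF A this, of "()"] that show ?thesis
    by (auto simp: Units_def ring_mat_def)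
qed

text \<open>Such a map misses the unit vector with index \<open>k\<close>. On a finite-dimensional
  space a map that is not surjective is not injective.\<close>

lemma module_hom_euclidean_kernel:
  assumes f: "f \<in> LinearCombinations.module_hom class_ring (euclidean_cspace n) (euclidean_cspace n)"
    and k: "k < n" "\<And>v. v \<in> carrier_vec n \<Longrightarrow> f v $ k = 0"
  shows "\<exists>v\<in>carrier_vec n. v \<noteq> 0\<^sub>v n \<and> f v = 0\<^sub>v n"
proof (rule ccontr)
  assume neg: "\<not> ?thesis"
  obtain A where A: "A \<in> carrier_mat n n" "\<And>v. v \<in> carrier_vec n \<Longrightarrow> f v = A *\<^sub>v v"
    using module_hom_euclidean_matrix[OF f] by blast
  obtain B where B: "B \<in> carrier_mat n n" "A * B = 1\<^sub>m n"
    using invertible_if_inj[OF A(1)] neg A(2) by metis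
  \<comment> \<open>If \<open>f\<close> were injective, the inverse matrix would give a preimage of
    the unit vector whose coordinate \<open>k\<close> is 1.\<close>
  have "f (B *\<^sub>v unit_vec n k) = A *\<^sub>v (B *\<^sub>v unit_vec n k)"
    using B by (intro A(2)) auto
  also have "\<dots> = (A * B) *\<^sub>v unit_vec n k"
    by (rule assoc_mult_mat_vec[OF A(1) B(1), symmetric]) simp
  also have "\<dots> = unit_vec n k" by (simp add: B)
  finally have "f (B *\<^sub>v unit_vec n k) $ k = 1" using k by simp
  moreover have "f (B *\<^sub>v unit_vec n k) $ k = 0"
    using B by (intro k) auto
  ultimately show False by simp
qed

locale euclidean_inner_product =
  fixes n :: nat and B :: "complex vec \<Rightarrow> complex vec \<Rightarrow> complex"
  assumes inner_product_space: "complex_inner_product_space (euclidean_form n B)"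
begin

sublocale K: complex_inner_product_space "euclidean_form n B"
  by (rule inner_product_space)

text \<open>Instead of Gram-Schmidt, a dimension count: \<open>k\<close> linear conditions with
  \<open>k < n\<close> have a common nonzero solution, which is orthogonal to the vectors found so
  far and only has to be normalised.\<close>

lemma ex_orthonormal:
  "k \<le> n \<Longrightarrow> \<exists>w. (\<forall>i<k. w i \<in> carrier_vec n) \<and> (\<forall>i<k. \<forall>j<k. B (w i) (w j) = (if i = j then 1 else 0))"
proof (induction k)
  case (Suc k)
  then obtain w where w: "\<And>i. i < k \<Longrightarrow> w i \<in> carrier_vec n"
    and on: "\<And>i j. i < k \<Longrightarrow> j < k \<Longrightarrow> B (w i) (w j) = (if i = j then 1 else 0)" by auto
  \<comment> \<open>Padding the \<open>k\<close> conditions with zeros makes \<open>f\<close> an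
    endomorphism of coordinate space whose coordinate \<open>k\<close> vanishes, as the kernel lemma
    requires.\<close>
  define f where "f v = vec n (\<lambda>i. if i < k then B v (w i) else 0)" for v
  have "f \<in> LinearCombinations.module_hom class_ring (euclidean_cspace n) (euclidean_cspace n)"
    using w K.cinner_add_left K.cinner_smult_left
    by (intro module_hom_classI) (auto simp: f_def intro!: eq_vecI)
  then obtain v where v: "v \<in> carrier_vec n" "v \<noteq> 0\<^sub>v n" "f v = 0\<^sub>v n"
    using module_hom_euclidean_kernel[of f n k] Suc.prems by (auto simp: f_def)
  have vw: "B v (w i) = 0" if "i < k" for i
    using that Suc.prems arg_cong[OF v(3), of "\<lambda>u. u $ i"] by (simp add: f_def)
  have wv: "B (w i) v = 0" if "i < k" for i
    using K.cinner_commute[of "w i" v] vw w v that by simp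
  define a where "a = hnorm (euclidean_form n B) v"
  have a: "a \<noteq> 0"
    using K.cinner_self[of v] K.cinner_eq_zero[of v] v by (auto simp: a_def)
  have Bvv: "B v v = of_real (a\<^sup>2)"
    using K.cinner_self[of v] v by (simp add: a_def)
  define u where "u = complex_of_real (1 / a) \<cdot>\<^sub>v v"
  have u: "u \<in> carrier_vec n" using v by (simp add: u_def)
  have left: "B u y = complex_of_real (1 / a) * B v y" if "y \<in> carrier_vec n" for y
    using K.cinner_smult_left[of v y "complex_of_real (1 / a)"] v that by (simp add: u_def)
  have right: "B y u = complex_of_real (1 / a) * B y v" if "y \<in> carrier_vec n" for y
    using K.cinner_smult_right[of y v "complex_of_real (1 / a)"] v that by (simp add: u_def)
  have "B u u = 1"
    using a v u by (simp add: left right Bvv power2_eq_square)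
  then show ?case
    using w on u vw wv v
    by (intro exI[of _ "w(k := u)"]) (auto simp: less_Suc_eq left right)
qed auto

text \<open>The columns of \<open>W\<close> are orthonormal for \<open>B\<close>, so by Parseval
  \<open>W\<close> carries the Euclidean norm to that of \<open>B\<close>. Preserving norms makes it
  injective, hence invertible.\<close>

lemma obtain_isometry:
  obtains W V where "W \<in> carrier_mat n n" "V \<in> carrier_mat n n" "W * V = 1\<^sub>m n" "V * W = 1\<^sub>m n"
    "\<And>v. v \<in> carrier_vec n \<Longrightarrow> hnorm (euclidean_form n B) (W *\<^sub>v v) = hnorm (euclidean_cspace n) v"
proof -
  obtain w where w: "\<And>i. i < n \<Longrightarrow> w i \<in> carrier_vec n"
    and on: "\<And>i j. i < n \<Longrightarrow> j < n \<Longrightarrow> B (w i) (w j) = (if i = j then 1 else 0)"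
    using ex_orthonormal[OF order_refl] by auto
  define W where "W = mat n n (\<lambda>(r, c). w c $ r)"
  have W: "W \<in> carrier_mat n n" by (simp add: W_def)
  have Wu: "W *\<^sub>v unit_vec n i = w i" if "i < n" for i
    using that w[OF that] by (intro eq_vecI) (auto simp: W_def)
  have hom: "(*\<^sub>v) W \<in> LinearCombinations.module_hom class_ring (euclidean_cspace n) (euclidean_form n B)"
    using mult_mat_vec_module_hom[OF W] by (simp add: LinearCombinations.module_hom_def)
  have iso: "hnorm (euclidean_form n B) (W *\<^sub>v v) = hnorm (euclidean_cspace n) v"
    if v: "v \<in> carrier_vec n" for v
  proof -
    have "W *\<^sub>v v = (\<Oplus>\<^bsub>euclidean_form n B\<^esub>i\<in>{..<n}. v $ i \<odot>\<^bsub>euclidean_form n B\<^esub> (W *\<^sub>v unit_vec n i))"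
      by (rule module_hom_euclidean_expand[OF K.module_axioms hom v])
    also have "hnorm (euclidean_form n B) \<dots> = sqrt (\<Sum>i<n. (cmod (v $ i))\<^sup>2)"
      using Wu w on by (intro K.hnorm_finsum_orthonormal) auto
    finally show ?thesis using v by (simp add: hnorm_euclidean)
  qed
  interpret E: complex_hilbert_space "euclidean_cspace n" by (rule complex_hilbert_space_euclidean)
  obtain V where "V \<in> carrier_mat n n" "W * V = 1\<^sub>m n" "V * W = 1\<^sub>m n"
  proof (rule invertible_if_inj[OF W])
    fix v assume v: "v \<in> carrier_vec n" "W *\<^sub>v v = 0\<^sub>v n"
    then have "hnorm (euclidean_cspace n) v = 0"
      using iso[of v] K.hnorm_zero by simp
    then show "v = 0\<^sub>v n"
      using v E.cinner_self[of v] E.cinner_eq_zero[of v] by simp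
  qed
  with W iso that show ?thesis by blast
qed

text \<open>The hypothesis \<open>P\<close> speaks of the Euclidean norm. Conjugation by the
  isometry \<open>W\<close> turns contractions for \<open>B\<close> into Euclidean contractions and
  keeps nilpotency and commutation, so \<open>P\<close> becomes a statement about any inner product
  on coordinate space.\<close>

lemma nilpotent_mats_criterion:
  assumes P: "\<And>M. commuting_contractive_nilpotent_mats n d M \<Longrightarrow> mat_opnorm (mat_poly n d p M) \<le> 1"
    and Z: "\<And>j. j < d \<Longrightarrow> Z j \<in> carrier_mat n n"
    and nil: "\<And>j. j < d \<Longrightarrow> nilpotent_mat (Z j)"
    and comm: "\<And>i j. i < d \<Longrightarrow> j < d \<Longrightarrow> Z i * Z j = Z j * Z i"
    and contr: "\<And>j v. j < d \<Longrightarrow> v \<in> carrier_vec n \<Longrightarrow>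
      hnorm (euclidean_form n B) (Z j *\<^sub>v v) \<le> hnorm (euclidean_form n B) v"
    and v: "v \<in> carrier_vec n"
  shows "hnorm (euclidean_form n B) (op_poly (euclidean_cspace n) d p (\<lambda>j. (*\<^sub>v) (Z j)) v)
    \<le> hnorm (euclidean_form n B) v"
proof -
  obtain W V where W: "W \<in> carrier_mat n n" and V: "V \<in> carrier_mat n n"
    and WV: "W * V = 1\<^sub>m n" and VW: "V * W = 1\<^sub>m n"
    and iso: "\<And>v. v \<in> carrier_vec n \<Longrightarrow> hnorm (euclidean_form n B) (W *\<^sub>v v) = hnorm (euclidean_cspace n) v"
    using obtain_isometry by blast
  interpret E: complex_hilbert_space "euclidean_cspace n" by (rule complex_hilbert_space_euclidean)
  define M where "M j = V * Z j * W" for j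
  have M: "M j \<in> carrier_mat n n" if "j < d" for j
    using W V Z[OF that] by (simp add: M_def)
  have WM: "W * M j = Z j * W" if "j < d" for j
  proof -
    have "W * M j = W * V * (Z j * W)"
      using W V Z[OF that] by (simp add: M_def assoc_mult_mat[of _ n n _ n _ n])
    then show ?thesis using W Z[OF that] by (simp add: WV)
  qed
  have WMv: "W *\<^sub>v (M j *\<^sub>v u) = Z j *\<^sub>v (W *\<^sub>v u)" if "j < d" "u \<in> carrier_vec n" for j u
    using WM[OF that(1)] assoc_mult_mat_vec[OF W M[OF that(1)] that(2)]
      assoc_mult_mat_vec[OF Z[OF that(1)] W that(2)] by simp
  have "mat_opnorm (M j) \<le> 1" if j: "j < d" for j
  proof -
    have "hnorm (euclidean_cspace n) (M j *\<^sub>v u) \<le> hnorm (euclidean_cspace n) u"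
      if u: "u \<in> carrier_vec n" for u
    proof -
      have "hnorm (euclidean_cspace n) (M j *\<^sub>v u) = hnorm (euclidean_form n B) (Z j *\<^sub>v (W *\<^sub>v u))"
        using M[OF j] u by (simp add: iso[symmetric] WMv[OF j u])
      also have "\<dots> \<le> hnorm (euclidean_form n B) (W *\<^sub>v u)"
        using W u by (intro contr j) auto
      finally show ?thesis using u by (simp add: iso)
    qed
    then show ?thesis
      using M[OF j] E.opnorm_leI[of "(*\<^sub>v) (M j)"] by (simp add: mat_opnorm_def)
  qed
  moreover have "nilpotent_mat (M j)" if j: "j < d" for j
  proof -
    obtain k where "Z j ^\<^sub>m k = 0\<^sub>m n n"
      using nil[OF j] Z[OF j] by (auto simp: nilpotent_mat_def)
    moreover have "similar_mat_wit (M j) (Z j) V W"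
      using W V Z[OF j] WV VW by (intro similar_mat_witI[of _ _ n]) (auto simp: M_def)
    ultimately have "M j ^\<^sub>m k = V * 0\<^sub>m n n * W"
      by (simp add: similar_mat_wit_pow_id)
    then show ?thesis
      using V W M[OF j] by (auto simp: nilpotent_mat_def)
  qed
  moreover have "M i * M j = M j * M i" if ij: "i < d" "j < d" for i j
  proof -
    \<comment> \<open>The inner factor \<open>W * V\<close> cancels, so a product of conjugates is
      the conjugate of the product and commutation carries over.\<close>
    have prod: "M i * M j = V * (Z i * Z j) * W" if "i < d" "j < d" for i j
    proof -
      have "M i * M j = V * Z i * (W * M j)"
        using V W Z[OF that(1)] M[OF that(2)] unfolding M_def[of i] by (intro assoc_mult_mat) auto
      also have "\<dots> = V * Z i * (Z j * W)" by (simp add: WM that)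
      also have "\<dots> = V * Z i * Z j * W"
        using V W Z[OF that(1)] Z[OF that(2)] by (intro assoc_mult_mat[symmetric]) auto
      also have "V * Z i * Z j = V * (Z i * Z j)"
        by (rule assoc_mult_mat[OF V Z[OF that(1)] Z[OF that(2)]])
      finally show ?thesis .
    qed
    show ?thesis using prod ij comm[OF ij] by simp
  qed
  ultimately have "commuting_contractive_nilpotent_mats n d M"
    using M by (auto simp: commuting_contractive_nilpotent_mats_def)
  from P[OF this] have le: "mat_opnorm (mat_poly n d p M) \<le> 1" .
  \<comment> \<open>The coordinates of \<open>v\<close> in the orthonormal basis given by the
    columns of \<open>W\<close>.\<close>
  define u where "u = V *\<^sub>v v"
  have u: "u \<in> carrier_vec n" "W *\<^sub>v u = v"
    using V v assoc_mult_mat_vec[OF W V v] by (auto simp: u_def WV)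
  have pM: "mat_poly n d p M \<in> carrier_mat n n" using M by (rule mat_poly_carrier)
  have "op_poly (euclidean_cspace n) d p (\<lambda>j. (*\<^sub>v) (Z j)) v
      = W *\<^sub>v op_poly (euclidean_cspace n) d p (\<lambda>j. (*\<^sub>v) (M j)) u"
    using op_poly_intertwine[OF module_euclidean module_euclidean mult_mat_vec_module_hom[OF W],
        of d "\<lambda>j. (*\<^sub>v) (M j)" "\<lambda>j. (*\<^sub>v) (Z j)" u p] WMv u mult_mat_vec_carrier[OF M] by auto
  also have "\<dots> = W *\<^sub>v (mat_poly n d p M *\<^sub>v u)"
    using M u by (simp add: mat_poly_mult_vec)
  finally have "hnorm (euclidean_form n B) (op_poly (euclidean_cspace n) d p (\<lambda>j. (*\<^sub>v) (Z j)) v)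
      = hnorm (euclidean_cspace n) (mat_poly n d p M *\<^sub>v u)"
    using pM u by (simp add: iso)
  also have "\<dots> \<le> hnorm (euclidean_cspace n) u"
    using le pM u E.contractive_hnorm_le[of "(*\<^sub>v) (mat_poly n d p M)"] by (simp add: contractive_mat_iff)
  also have "\<dots> = hnorm (euclidean_form n B) v" using iso[OF u(1)] u by simp
  finally show ?thesis .
qed

end

section \<open>Transport of Hilbert spaces along bijections\<close>

text \<open>Transport of structure. Besides copying a space into another type, the case of the
  identity map replaces the inner product on a fixed vector space.\<close>

lemma vectorspace_iso:
  assumes K: "vectorspace class_ring K" and f: "bij_betw f (carrier K) (carrier H)"
    and add: "\<And>x y. x \<in> carrier K \<Longrightarrow> y \<in> carrier K \<Longrightarrow> f (x \<oplus>\<^bsub>K\<^esub> y) = f x \<oplus>\<^bsub>H\<^esub> f y"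
    and smult: "\<And>c x. x \<in> carrier K \<Longrightarrow> f (c \<odot>\<^bsub>K\<^esub> x) = c \<odot>\<^bsub>H\<^esub> f x"
    and zero: "f \<zero>\<^bsub>K\<^esub> = \<zero>\<^bsub>H\<^esub>"
  shows "vectorspace (class_ring :: complex ring) H"
proof -
  interpret K: vectorspace class_ring K by fact
  have im: "carrier H = f ` carrier K" using f by (simp add: bij_betw_def)
  have "abelian_group H"
  proof (rule abelian_groupI)
    fix x assume "x \<in> carrier H"
    then obtain y where y: "y \<in> carrier K" "x = f y" unfolding im by blast
    then have "f (\<ominus>\<^bsub>K\<^esub> y) \<oplus>\<^bsub>H\<^esub> x = \<zero>\<^bsub>H\<^esub>"
      by (simp add: add[symmetric] zero K.M.l_neg)
    with y show "\<exists>y\<in>carrier H. y \<oplus>\<^bsub>H\<^esub> x = \<zero>\<^bsub>H\<^esub>" unfolding im by blast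
  qed (auto simp: im add[symmetric] zero[symmetric] K.M.a_assoc intro!: arg_cong[of _ _ f] K.M.a_comm)
  moreover have "cring (class_ring :: complex ring)"
    by (rule class_cring.is_cring)
  ultimately have "Module.module (class_ring :: complex ring) H"
    using K.smult_l_distr K.smult_r_distr K.smult_assoc1 K.smult_one
    by (intro Module.moduleI) (auto simp: im add[symmetric] smult[symmetric])
  then show ?thesis
    by (intro vectorspace.intro) (auto intro: class_field.field_axioms class_field)
qed

lemma complex_hilbert_space_iso:
  fixes K :: "'a cinner_space" and H :: "'b cinner_space"
  assumes K: "complex_hilbert_space K" and f: "bij_betw f (carrier K) (carrier H)"
    and add: "\<And>x y. x \<in> carrier K \<Longrightarrow> y \<in> carrier K \<Longrightarrow> f (x \<oplus>\<^bsub>K\<^esub> y) = f x \<oplus>\<^bsub>H\<^esub> f y"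
    and smult: "\<And>c x. x \<in> carrier K \<Longrightarrow> f (c \<odot>\<^bsub>K\<^esub> x) = c \<odot>\<^bsub>H\<^esub> f x"
    and zero: "f \<zero>\<^bsub>K\<^esub> = \<zero>\<^bsub>H\<^esub>"
    and inner: "\<And>x y. x \<in> carrier K \<Longrightarrow> y \<in> carrier K \<Longrightarrow> cinner H (f x) (f y) = cinner K x y"
  shows "complex_hilbert_space H"
proof -
  interpret K: complex_hilbert_space K by fact
  interpret H: vectorspace class_ring H
    by (rule vectorspace_iso[OF K.vectorspace_axioms f add smult zero])
  have im: "carrier H = f ` carrier K" using f by (simp add: bij_betw_def)
  have norm: "hnorm H (f x) = hnorm K x" if "x \<in> carrier K" for x
    using that by (simp add: hnorm_def inner)
  have neg: "\<ominus>\<^bsub>H\<^esub> f x = f (\<ominus>\<^bsub>K\<^esub> x)" if x: "x \<in> carrier K" for x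
    by (rule H.minus_equality)
      (use x in \<open>auto simp: im add[symmetric] zero[symmetric] K.M.l_neg\<close>)
  have minus: "f x \<ominus>\<^bsub>H\<^esub> f y = f (x \<ominus>\<^bsub>K\<^esub> y)" if "x \<in> carrier K" "y \<in> carrier K" for x y
    using that by (simp add: a_minus_def neg add)
  show ?thesis
  proof (unfold_locales, goal_cases)
    case (1 x y z)
    then show ?case by (auto simp: im add[symmetric] inner K.cinner_add_left)
  next
    case (2 x y c)
    then show ?case by (auto simp: im smult[symmetric] inner K.cinner_smult_left)
  next
    case (3 x y)
    then obtain x' y' where "x = f x'" "y = f y'" "x' \<in> carrier K" "y' \<in> carrier K"
      unfolding im by blast
    then show ?case using K.cinner_commute[of x' y'] by (simp add: inner)
  next
    case (4 x)
    then show ?case by (auto simp: im inner K.cinner_nonneg)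
  next
    case (5 x)
    then show ?case using K.cinner_eq_zero by (auto simp: im inner zero[symmetric])
  next
    case (6 s)
    then have "\<forall>k. \<exists>y. y \<in> carrier K \<and> s k = f y" unfolding im by blast
    then obtain r where r: "\<And>k. r k \<in> carrier K" "\<And>k. s k = f (r k)" by metis
    have "\<exists>x\<in>carrier K. (\<lambda>k. hnorm K (r k \<ominus>\<^bsub>K\<^esub> x)) \<longlonglongrightarrow> 0"
      using 6(2) r by (intro K.complete) (auto simp: minus norm)
    then obtain x where "x \<in> carrier K" "(\<lambda>k. hnorm K (r k \<ominus>\<^bsub>K\<^esub> x)) \<longlonglongrightarrow> 0" by blast
    then show ?case
      using r by (intro bexI[of _ "f x"]) (auto simp: minus norm im)
  qed
qed

text \<open>Splitting off the first coordinate reduces the claim to the fact that the square of an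
  infinite set has the cardinality of the set.\<close>

lemma carrier_vec_lepoll: "(carrier_vec n :: complex vec set) \<lesssim> (UNIV :: complex set)"
proof (induction n)
  case 0
  have "(carrier_vec 0 :: complex vec set) \<lesssim> {0 :: complex}"
    by (auto simp: lepoll_def inj_on_def intro!: exI[of _ "\<lambda>_. 0"])
  then show ?case by (meson lepoll_trans subset_imp_lepoll subset_UNIV)
next
  case (Suc n)
  have "(carrier_vec (Suc n) :: complex vec set) \<lesssim> (UNIV :: complex set) \<times> (carrier_vec n :: complex vec set)"
    unfolding lepoll_def
  proof (intro exI[of _ "\<lambda>v. (v $ 0, vec n (\<lambda>i. v $ Suc i))"] conjI)
    show "inj_on (\<lambda>v. (v $ 0, vec n (\<lambda>i. v $ Suc i))) (carrier_vec (Suc n) :: complex vec set)"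
    proof (rule inj_onI)
      fix v w :: "complex vec"
      assume vw: "v \<in> carrier_vec (Suc n)" "w \<in> carrier_vec (Suc n)"
        and eq: "(v $ 0, vec n (\<lambda>i. v $ Suc i)) = (w $ 0, vec n (\<lambda>i. w $ Suc i))"
      have "v $ Suc i = w $ Suc i" if "i < n" for i
        using that eq by (metis index_vec prod.inject)
      then have "v $ i = w $ i" if "i < Suc n" for i
        using that eq by (cases i) auto
      then show "v = w" using vw by (intro eq_vecI) auto
    qed
  qed auto
  also have "\<dots> \<lesssim> (UNIV :: complex set) \<times> (UNIV :: complex set)"
    by (intro times_lepoll_mono Suc.IH lepoll_refl)
  also have "\<dots> \<lesssim> (UNIV :: complex set)"
    using card_of_Times_same_infinite[of "UNIV :: complex set"] infinite_UNIV_char_0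
    by (auto simp: lepoll_def card_of_ordIso[symmetric] bij_betw_def dest: ordIso_imp_ordLeq)
  finally show ?case .
qed

text \<open>The Hilbert spaces in \<open>P\<close> live on the fixed type \<open>'a\<close>, while
  matrices act on \<open>complex vec\<close>. The cardinality assumption yields an injection of
  coordinate space into \<open>'a\<close>, and its image with the transported structure is a Hilbert
  space to which \<open>P\<close> applies.\<close>

lemma mat_opnorm_mat_poly_le_if_hilbert:
  assumes card: "(UNIV :: complex set) \<lesssim> (UNIV :: 'a set)"
    and P: "\<And>(H :: 'a cinner_space) T. complex_hilbert_space H \<Longrightarrow> commuting_contractive_tuple H d T
              \<Longrightarrow> opnorm H (op_poly H d p T) \<le> 1"
    and M: "commuting_contractive_nilpotent_mats n d M"
  shows "mat_opnorm (mat_poly n d p M) \<le> 1"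
proof -
  have Mc: "M j \<in> carrier_mat n n" if "j < d" for j
    using M that by (simp add: commuting_contractive_nilpotent_mats_def)
  obtain f :: "complex vec \<Rightarrow> 'a" where f: "inj_on f (carrier_vec n)"
    using lepoll_trans[OF carrier_vec_lepoll card] by (auto simp: lepoll_def)
  define g where "g = inv_into (carrier_vec n) f"
  have gf: "g (f v) = v" if "v \<in> carrier_vec n" for v
    using that f by (simp add: g_def)
  \<comment> \<open>Every operation is computed in coordinate space through \<open>g\<close> and
    carried back by \<open>f\<close>, so \<open>f\<close> is an isometric isomorphism onto
    \<open>H\<close>.\<close>
  define H :: "'a cinner_space" where
    "H = \<lparr>carrier = f ` carrier_vec n, mult = undefined, one = undefined, zero = f (0\<^sub>v n),
      add = (\<lambda>x y. f (g x + g y)), smult = (\<lambda>c x. f (c \<cdot>\<^sub>v g x)), cinner = (\<lambda>x y. g x \<bullet>c g y)\<rparr>"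
  have car: "carrier H = f ` carrier_vec n" by (simp add: H_def)
  have cinner: "cinner H (f v) (f w) = cinner (euclidean_cspace n) v w"
    if "v \<in> carrier_vec n" "w \<in> carrier_vec n" for v w
    using that by (simp add: H_def gf euclidean_cspace_def)
  have smult: "f (c \<odot>\<^bsub>euclidean_cspace n\<^esub> v) = c \<odot>\<^bsub>H\<^esub> f v" if "v \<in> carrier_vec n" for c v
    using that by (simp add: H_def gf)
  have add: "f (v \<oplus>\<^bsub>euclidean_cspace n\<^esub> w) = f v \<oplus>\<^bsub>H\<^esub> f w"
    if "v \<in> carrier_vec n" "w \<in> carrier_vec n" for v w
    using that by (simp add: H_def gf)
  have hilb: "complex_hilbert_space H"
    by (rule complex_hilbert_space_iso[OF complex_hilbert_space_euclidean[of n], of f])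
      (use f in \<open>auto simp: cinner smult[symmetric] add[symmetric] bij_betw_def car, auto simp: H_def\<close>)
  interpret H: complex_hilbert_space H by (rule hilb)
  interpret E: complex_hilbert_space "euclidean_cspace n" by (rule complex_hilbert_space_euclidean)
  have norm: "hnorm H (f v) = hnorm (euclidean_cspace n) v" if "v \<in> carrier_vec n" for v
    using that by (simp add: hnorm_def cinner)
  define T where "T j x = f (M j *\<^sub>v g x)" for j x
  have Tf: "T j (f v) = f (M j *\<^sub>v v)" if "v \<in> carrier_vec n" for j v
    using that by (simp add: T_def gf)
  have homf: "f \<in> LinearCombinations.module_hom class_ring (euclidean_cspace n) H"
    using smult add by (intro module_hom_classI) (auto simp: car)
  have "contractive H (T j)" if j: "j < d" for j
  proof -
    have Mv: "M j *\<^sub>v v \<in> carrier_vec n" if "v \<in> carrier_vec n" for v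
      using Mc[OF j] that by simp
    have le: "hnorm H (T j x) \<le> hnorm H x" if "x \<in> carrier H" for x
      using that M Mc[OF j] j E.contractive_hnorm_le[of "(*\<^sub>v) (M j)"] contractive_mat_iff[OF Mc[OF j]]
      by (auto simp: car Tf norm Mv commuting_contractive_nilpotent_mats_def)
    have "T j \<in> LinearCombinations.module_hom class_ring H H"
      using Mv Mc[OF j]
      by (intro module_hom_classI)
        (auto simp: car Tf add[symmetric] smult[symmetric] mult_add_distrib_mat_vec mult_mat_vec)
    with le show ?thesis
      using H.opnorm_leI[OF le] by (auto simp: contractive_def bounded_operator_def intro!: exI[of _ 1])
  qed
  moreover have "T i (T j x) = T j (T i x)" if ij: "i < d" "j < d" and x: "x \<in> carrier H" for i j x
  proof -
    obtain v where v: "v \<in> carrier_vec n" "x = f v" using x by (auto simp: car)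
    have "T k (T l x) = f (M k * M l *\<^sub>v v)" if "k < d" "l < d" for k l
      using v mult_mat_vec_carrier[OF Mc[OF that(2)] v(1)]
        assoc_mult_mat_vec[OF Mc[OF that(1)] Mc[OF that(2)] v(1)] by (simp add: Tf)
    moreover have "M i * M j = M j * M i"
      using M ij by (simp add: commuting_contractive_nilpotent_mats_def)
    ultimately show ?thesis using ij by simp
  qed
  ultimately have "commuting_contractive_tuple H d T"
    by (simp add: commuting_contractive_tuple_def)
  from P[OF hilb this] have "opnorm H (op_poly H d p T) \<le> 1" .
  moreover have op: "op_poly H d p T (f v) = f (mat_poly n d p M *\<^sub>v v)" if "v \<in> carrier_vec n" for v
    using that Mc op_poly_intertwine[OF module_euclidean H.module_axioms homf,
        of d "\<lambda>j. (*\<^sub>v) (M j)" T v p] mult_mat_vec_carrier[OF Mc]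
    by (auto simp: Tf mat_poly_mult_vec)
  have "opnorm H (op_poly H d p T) = opnorm (euclidean_cspace n) ((*\<^sub>v) (mat_poly n d p M))"
  proof -
    have "hnorm H (op_poly H d p T (f v)) = hnorm (euclidean_cspace n) (mat_poly n d p M *\<^sub>v v)"
      if "v \<in> carrier_vec n" for v
      using that mat_poly_carrier[of d M n p] Mc by (simp add: op norm)
    \<comment> \<open>Since \<open>f\<close> is isometric and onto the carrier, the two operator
      norms are suprema of the same set.\<close>
    then have "{hnorm H (op_poly H d p T x) |x. x \<in> carrier H \<and> hnorm H x \<le> 1}
        = {hnorm (euclidean_cspace n) (mat_poly n d p M *\<^sub>v v) |v.
            v \<in> carrier (euclidean_cspace n) \<and> hnorm (euclidean_cspace n) v \<le> 1}"
      by (auto simp: car norm) (metis imageI norm)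
    then show ?thesis by (simp only: opnorm_def)
  qed
  ultimately show ?thesis
    using mat_poly_carrier[of d M n p] Mc by (simp add: mat_opnorm_def)
qed

section \<open>Monomials\<close>

text \<open>An operator that commutes with the tuple intertwines the tuple with itself.\<close>

lemma op_monom_commute:
  assumes T: "\<And>i x. i < k \<Longrightarrow> x \<in> carrier H \<Longrightarrow> T i x \<in> carrier H"
    and comm: "\<And>i x. i < k \<Longrightarrow> x \<in> carrier H \<Longrightarrow> S (T i x) = T i (S x)"
    and x: "x \<in> carrier H"
  shows "op_monom T m k (S x) = S (op_monom T m k x)"
  using op_monom_intertwine[of k H T S T x m] assms by simp

text \<open>Multiplying a monomial by a variable corresponds to applying \<open>T j\<close>. The
  induction follows the partial products of \<open>op_monom\<close>, in which the factor with index
  \<open>j\<close> occurs only once \<open>j < k\<close>.\<close>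

lemma op_monom_add_single:
  assumes T: "\<And>i x. i < d \<Longrightarrow> x \<in> carrier H \<Longrightarrow> T i x \<in> carrier H"
    and comm: "\<And>i j x. i < d \<Longrightarrow> j < d \<Longrightarrow> x \<in> carrier H \<Longrightarrow> T i (T j x) = T j (T i x)"
    and j: "j < d" and x: "x \<in> carrier H" and "k \<le> d"
  shows "op_monom T (m + Poly_Mapping.single j 1) k x
    = (if j < k then T j (op_monom T m k x) else op_monom T m k x)"
  using \<open>k \<le> d\<close> x
proof (induction k arbitrary: x)
  case (Suc k)
  have pow: "(T k ^^ i) x \<in> carrier H" for i
    using Suc.prems T by (induction i) auto
  show ?case
  proof (cases "j = k")
    case True
    \<comment> \<open>The additional factor \<open>T k\<close> is applied first in
      \<open>op_monom\<close> and has to be moved past the factors of smaller index.\<close>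
    have "op_monom T m k (T k ((T k ^^ i) x)) = T k (op_monom T m k ((T k ^^ i) x))" for i
      using Suc.prems pow T comm by (intro op_monom_commute[of k H T "T k"]) auto
    then show ?thesis
      using True Suc.IH[OF _ pow[of "Suc (Poly_Mapping.lookup m k)"]] Suc.prems
      by (simp add: lookup_add)
  next
    case False
    then show ?thesis
      using Suc.IH[OF _ pow] Suc.prems by (auto simp: lookup_add lookup_single)
  qed
qed simp

text \<open>If each \<open>S j\<close> raises the exponent of variable \<open>j\<close> by one on
  the family \<open>E\<close>, a monomial in \<open>S\<close> adds its whole exponent vector.
  Starting at exponent 0, this is what makes \<open>p(Z) 1 = p\<close>.\<close>

lemma op_monom_translate:
  assumes "\<And>j m. j < k \<Longrightarrow> S j (E m) = E (m + Poly_Mapping.single j 1)"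
  shows "op_monom S m k (E m') = E (m' + (\<Sum>i<k. Poly_Mapping.single i (Poly_Mapping.lookup m i)))"
proof -
  have pow: "(S j ^^ i) (E m) = E (m + Poly_Mapping.single j i)" if "j < k" for i j m
    using that assms[of j]
    by (induction i) (simp_all add: add.assoc single_add[symmetric])
  show ?thesis
    using pow by (induction k arbitrary: m') (simp_all add: add_ac)
qed

lemma poly_mapping_eq_sum_single:
  fixes m :: "nat \<Rightarrow>\<^sub>0 nat"
  assumes "Poly_Mapping.keys m \<subseteq> {..<d}"
  shows "(\<Sum>i<d. Poly_Mapping.single i (Poly_Mapping.lookup m i)) = m"
proof (rule poly_mapping_eqI)
  fix k
  have "(\<Sum>i<d. Poly_Mapping.lookup (Poly_Mapping.single i (Poly_Mapping.lookup m i)) k)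
      = (\<Sum>i<d. if i = k then Poly_Mapping.lookup m i else 0)"
    by (intro sum.cong) (auto simp: lookup_single)
  then show "Poly_Mapping.lookup (\<Sum>i<d. Poly_Mapping.single i (Poly_Mapping.lookup m i)) k
      = Poly_Mapping.lookup m k"
    using assms by (cases "k < d") (auto simp: lookup_sum in_keys_iff)
qed

text \<open>Summing over a fixed range rather than over the keys makes the degree additive without
  side conditions.\<close>

definition deg_in :: "nat \<Rightarrow> (nat \<Rightarrow>\<^sub>0 nat) \<Rightarrow> nat" where
  "deg_in d m = (\<Sum>i<d. Poly_Mapping.lookup m i)"

lemma deg_in_add: "deg_in d (m + m') = deg_in d m + deg_in d m'"
  by (simp add: deg_in_def lookup_add sum.distrib)

lemma deg_in_single: "j < d \<Longrightarrow> deg_in d (Poly_Mapping.single j k) = k"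
  by (simp add: deg_in_def lookup_single when_def)

text \<open>Exponents are natural numbers and cannot cancel.\<close>

lemma keys_add_nat: "Poly_Mapping.keys (m + m') = Poly_Mapping.keys m \<union> Poly_Mapping.keys (m' :: nat \<Rightarrow>\<^sub>0 nat)"
  by (auto simp: in_keys_iff lookup_add)

text \<open>Such a monomial is determined by its first \<open>d\<close> exponents, each of which is
  below \<open>N\<close>.\<close>

lemma finite_monoms_deg_less:
  "finite {m. Poly_Mapping.keys m \<subseteq> {..<d} \<and> deg_in d m < N}"
proof (rule finite_imageD)
  let ?A = "{m. Poly_Mapping.keys m \<subseteq> {..<d} \<and> deg_in d m < N}"
  let ?f = "\<lambda>m. restrict (Poly_Mapping.lookup m) {..<d}"
  have "Poly_Mapping.lookup m i < N" if "m \<in> ?A" "i < d" for m i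
    using that member_le_sum[of i "{..<d}" "Poly_Mapping.lookup m"] by (auto simp: deg_in_def)
  then have "?f ` ?A \<subseteq> {..<d} \<rightarrow>\<^sub>E {..<N}" by (simp add: image_subset_iff restrict_PiE_iff)
  then show "finite (?f ` ?A)" by (rule finite_subset) (auto intro: finite_PiE)
  show "inj_on ?f ?A"
  proof (rule inj_onI, rule poly_mapping_eqI)
    fix m m' k
    assume m: "m \<in> ?A" "m' \<in> ?A" and eq: "?f m = ?f m'"
    show "Poly_Mapping.lookup m k = Poly_Mapping.lookup m' k"
    proof (cases "k < d")
      case True
      then show ?thesis using fun_cong[OF eq, of k] by simp
    next
      case False
      then have "k \<notin> Poly_Mapping.keys m" "k \<notin> Poly_Mapping.keys m'" using m by auto
      then show ?thesis by (simp add: in_keys_iff)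
    qed
  qed
qed

section \<open>Truncated multiplication by the variables\<close>

text \<open>
  \<open>E\<close> sends a monomial in \<open>I\<close> to its basis vector and all other monomials to \<open>0\<close>, so that truncation needs no
  case distinction in \<open>Z j *\<^sub>v E m = E (m + Poly_Mapping.single j 1)\<close>.
\<close>

lemma truncated_shift_matrices:
  fixes d N :: nat
  assumes I_def: "I = {m. Poly_Mapping.keys m \<subseteq> {..<d} \<and> deg_in d m < N}" and n: "n = card I"
  obtains e :: "nat \<Rightarrow> nat \<Rightarrow>\<^sub>0 nat" and E and Z :: "nat \<Rightarrow> complex mat"
  where "bij_betw e {..<n} I"
    "\<And>c. c < n \<Longrightarrow> E (e c) = unit_vec n c" "\<And>m. m \<notin> I \<Longrightarrow> E m = 0\<^sub>v n" "\<And>m. E m \<in> carrier_vec n"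
    "\<And>j. Z j \<in> carrier_mat n n"
    "\<And>j m. j < d \<Longrightarrow> Z j *\<^sub>v E m = E (m + Poly_Mapping.single j 1)"
    "\<And>j. j < d \<Longrightarrow> nilpotent_mat (Z j)"
    "\<And>i j. i < d \<Longrightarrow> j < d \<Longrightarrow> Z i * Z j = Z j * Z i"
    "\<And>j v. j < d \<Longrightarrow> v \<in> carrier_vec n \<Longrightarrow>
      hnorm (euclidean_cspace n) (Z j *\<^sub>v v) \<le> hnorm (euclidean_cspace n) v"
proof -
  interpret Eu: complex_hilbert_space "euclidean_cspace n" by (rule complex_hilbert_space_euclidean)
  have finI: "finite I" unfolding I_def by (rule finite_monoms_deg_less)
  obtain e where e: "bij_betw e {..<n} I"
    using ex_bij_betw_nat_finite[OF finI] by (auto simp: n atLeast0LessThan)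
  have eI: "e c \<in> I" if "c < n" for c using e that by (auto simp: bij_betw_def)
  define E where "E m = (if m \<in> I then unit_vec n (inv_into {..<n} e m) else 0\<^sub>v n :: complex vec)" for m
  have Ee: "E (e c) = unit_vec n c" if "c < n" for c
    using that eI e by (auto simp: E_def bij_betw_def)
  have E0: "E m = 0\<^sub>v n" if "m \<notin> I" for m using that by (simp add: E_def)
  have Ec: "E m \<in> carrier_vec n" for m by (simp add: E_def)
  \<comment> \<open>Column \<open>c\<close> is the product of the basis monomial \<open>e c\<close>
    with variable \<open>j\<close>, or zero if that product is truncated.\<close>
  define Z where "Z j = mat n n (\<lambda>(r, c). E (e c + Poly_Mapping.single j 1) $ r)" for j
  have Zc: "Z j \<in> carrier_mat n n" for j by (simp add: Z_def)
  have Zu: "Z j *\<^sub>v unit_vec n c = E (e c + Poly_Mapping.single j 1)" if "c < n" for j c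
    using that Ec[of "e c + Poly_Mapping.single j 1"] by (intro eq_vecI) (auto simp: Z_def)
  have ZE: "Z j *\<^sub>v E m = E (m + Poly_Mapping.single j 1)" if j: "j < d" for j m
  proof (cases "m \<in> I")
    case True
    then obtain c where "c < n" "m = e c" using e by (auto simp: bij_betw_def)
    then show ?thesis by (simp add: Ee Zu)
  next
    \<comment> \<open>Multiplication by a variable neither lowers the degree nor removes a variable,
      so it does not lead back into \<open>I\<close> and both sides are zero.\<close>
    case False
    then have "m + Poly_Mapping.single j 1 \<notin> I"
      by (auto simp: I_def keys_add_nat deg_in_add)
    then show ?thesis using False Zc[of j] by (auto simp: E0 intro!: eq_vecI)
  qed
  have comm: "Z i * Z j = Z j * Z i" if ij: "i < d" "j < d" for i j
  proof (rule eq_mat_on_unit_vecI)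
    fix c assume c: "c < n"
    have "Z i * Z j *\<^sub>v unit_vec n c = E (e c + Poly_Mapping.single j 1 + Poly_Mapping.single i 1)"
      if "i < d" for i j
      using c that assoc_mult_mat_vec[OF Zc Zc, of "unit_vec n c" i j] by (simp add: Zu ZE)
    then show "Z i * Z j *\<^sub>v unit_vec n c = Z j * Z i *\<^sub>v unit_vec n c"
      using ij by (simp add: add_ac)
  qed (rule mult_carrier_mat[OF Zc Zc])+
  have nil: "nilpotent_mat (Z j)" if j: "j < d" for j
  proof -
    have pow: "(((*\<^sub>v) (Z j)) ^^ k) (E m) = E (m + Poly_Mapping.single j k)" for k m
      by (induction k) (simp_all add: ZE[OF j] add.assoc single_add[symmetric])
    \<comment> \<open>The power \<open>N\<close> raises every degree by \<open>N\<close>, beyond the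
      truncation.\<close>
    have "Z j ^\<^sub>m N = 0\<^sub>m n n"
    proof (rule eq_mat_on_unit_vecI)
      fix c assume c: "c < n"
      have "e c + Poly_Mapping.single j N \<notin> I"
        using j by (auto simp: I_def deg_in_add deg_in_single)
      then show "Z j ^\<^sub>m N *\<^sub>v unit_vec n c = 0\<^sub>m n n *\<^sub>v unit_vec n c"
        using c Ec[of "e c"] by (auto simp: pow_mat_mult_vec[OF Zc] Ee[symmetric] pow E0 intro!: eq_vecI)
    qed (use Zc in auto)
    then show ?thesis using Zc[of j] by (auto simp: nilpotent_mat_def)
  qed
  have contr: "hnorm (euclidean_cspace n) (Z j *\<^sub>v v) \<le> hnorm (euclidean_cspace n) v"
    if j: "j < d" and v: "v \<in> carrier_vec n" for j v
  proof -
    define s where "s c = e c + Poly_Mapping.single j 1" for c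
    \<comment> \<open>The basis monomials that survive multiplication by variable \<open>j\<close>.
      Multiplication is injective on them, so their images are orthonormal and the norm only loses
      the coefficients outside \<open>J\<close>.\<close>
    define J where "J = {c. c < n \<and> s c \<in> I}"
    have "Z j *\<^sub>v v = (\<Oplus>\<^bsub>euclidean_cspace n\<^esub>c\<in>{..<n}. v $ c \<odot>\<^bsub>euclidean_cspace n\<^esub> (Z j *\<^sub>v unit_vec n c))"
      by (rule module_hom_euclidean_expand[OF module_euclidean mult_mat_vec_module_hom[OF Zc] v])
    also have "\<dots> = (\<Oplus>\<^bsub>euclidean_cspace n\<^esub>c\<in>J. v $ c \<odot>\<^bsub>euclidean_cspace n\<^esub> E (s c))"
      using Ec Zu E0
      by (intro Eu.M.add.finprod_mono_neutral_cong_right) (auto simp: J_def s_def)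
    also have "hnorm (euclidean_cspace n) \<dots> = sqrt (\<Sum>c\<in>J. (cmod (v $ c))\<^sup>2)"
    proof (rule Eu.hnorm_finsum_orthonormal)
      fix b c assume bc: "b \<in> J" "c \<in> J"
      then obtain b' c' where b': "s b = e b'" "b' < n" and c': "s c = e c'" "c' < n"
        using e by (auto simp: J_def bij_betw_def)
      have "s b = s c \<longleftrightarrow> b = c"
        using bc e by (auto simp: J_def s_def bij_betw_def dest: inj_onD)
      moreover have "s b = s c \<longleftrightarrow> b' = c'"
        using b' c' e by (auto simp: bij_betw_def dest: inj_onD)
      moreover have "cinner (euclidean_cspace n) (unit_vec n b') (unit_vec n c') = (if b' = c' then 1 else 0)"
        using b' c' by (simp add: cinner_euclidean if_distrib cong: if_cong)
      ultimately show "cinner (euclidean_cspace n) (E (s b)) (E (s c)) = (if b = c then 1 else 0)"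
        using b' c' Ee by simp
    qed (auto simp: J_def Ec)
    also have "\<dots> \<le> sqrt (\<Sum>c<n. (cmod (v $ c))\<^sup>2)"
      by (intro real_sqrt_le_mono sum_mono2) (auto simp: J_def)
    also have "\<dots> = hnorm (euclidean_cspace n) v" using v by (simp add: hnorm_euclidean)
    finally show ?thesis .
  qed
  show thesis by (rule that[of e E Z]) (fact e Ee E0 Ec Zc ZE nil comm contr)+
qed

text \<open>The form pulled back along \<open>L k\<close> is only semidefinite, since
  \<open>L k\<close> may have a kernel; the Euclidean summand makes the total definite.\<close>

lemma (in complex_inner_product_space) euclidean_inner_product_pullback:
  assumes L: "\<And>k. L k \<in> LinearCombinations.module_hom class_ring (euclidean_cspace n) H"
  shows "euclidean_inner_product n
    (\<lambda>v w. (\<Sum>k<N. cinner H (L k v) (L k w)) + cinner (euclidean_cspace n) v w)"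
    (is "euclidean_inner_product n ?B")
proof -
  interpret E: complex_hilbert_space "euclidean_cspace n" by (rule complex_hilbert_space_euclidean)
  have Lc: "L k v \<in> carrier H" if "v \<in> carrier_vec n" for k v
    using module_hom_in_carrier[OF L] that by simp
  have Ladd: "L k (v + w) = L k v \<oplus>\<^bsub>H\<^esub> L k w" if "v \<in> carrier_vec n" "w \<in> carrier_vec n" for k v w
    using LinearCombinations.module_hom_add[OF L, of v w] that by simp
  have Lsm: "L k (c \<cdot>\<^sub>v v) = c \<odot>\<^bsub>H\<^esub> L k v" if "v \<in> carrier_vec n" for k c v
    using module_hom_class_smult[OF L, of v k c] that by simp
  \<comment> \<open>Only the inner product changes, so the identity map transports the vector space
    laws.\<close>
  interpret K: vectorspace class_ring "euclidean_form n ?B"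
    by (rule vectorspace_iso[OF vectorspace_euclidean[of n], of id]) (auto simp: bij_betw_def)
  have self: "?B v v = of_real ((\<Sum>k<N. (hnorm H (L k v))\<^sup>2) + (hnorm (euclidean_cspace n) v)\<^sup>2)"
    if "v \<in> carrier_vec n" for v
    using that Lc E.cinner_self[of v] by (simp add: cinner_self)
  have "complex_inner_product_space (euclidean_form n ?B)"
  proof (unfold_locales, goal_cases)
    case (1 x y z)
    then show ?case using E.cinner_add_left[of x y z]
      by (simp add: Lc Ladd cinner_add_left sum.distrib)
  next
    case (2 x y c)
    then show ?case using E.cinner_smult_left[of x y c]
      by (simp add: Lc Lsm cinner_smult_left sum_distrib_left distrib_left)
  next
    case (3 x y)
    then have "cinner H (L k x) (L k y) = cnj (cinner H (L k y) (L k x))" for k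
      using cinner_commute[of "L k x" "L k y"] Lc by simp
    then show ?case using 3 E.cinner_commute[of x y] by simp
  next
    case (4 x)
    then show ?case by (simp add: self sum_nonneg)
  next
    case (5 x)
    then have x: "x \<in> carrier_vec n" by simp
    have "complex_of_real ((\<Sum>k<N. (hnorm H (L k x))\<^sup>2) + (hnorm (euclidean_cspace n) x)\<^sup>2) = 0"
      unfolding self[OF x, symmetric] using 5(2) by simp
    then have "(\<Sum>k<N. (hnorm H (L k x))\<^sup>2) + (hnorm (euclidean_cspace n) x)\<^sup>2 = 0"
      by (simp only: of_real_eq_0_iff)
    moreover have "0 \<le> (\<Sum>k<N. (hnorm H (L k x))\<^sup>2)" by (intro sum_nonneg) auto
    ultimately have "hnorm (euclidean_cspace n) x = 0"
      by (smt (verit) zero_le_power2 zero_eq_power2)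
    then show ?case using x E.cinner_self[of x] E.cinner_eq_zero[of x] by simp
  qed
  then show ?thesis by (rule euclidean_inner_product.intro)
qed

lemma (in complex_inner_product_space) hnorm_pullback:
  assumes L: "\<And>k. L k \<in> LinearCombinations.module_hom class_ring (euclidean_cspace n) H"
    and v: "v \<in> carrier_vec n"
  shows "(hnorm (euclidean_form n (\<lambda>v w. (\<Sum>k<N. cinner H (L k v) (L k w)) + cinner (euclidean_cspace n) v w)) v)\<^sup>2
    = (\<Sum>k<N. (hnorm H (L k v))\<^sup>2) + (hnorm (euclidean_cspace n) v)\<^sup>2"
proof -
  interpret E: complex_hilbert_space "euclidean_cspace n" by (rule complex_hilbert_space_euclidean)
  have Lc: "L k v \<in> carrier H" for k
    using module_hom_in_carrier[OF L] v by simp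
  have "0 \<le> (\<Sum>k<N. (hnorm H (L k v))\<^sup>2) + (hnorm (euclidean_cspace n) v)\<^sup>2"
    by (intro add_nonneg_nonneg sum_nonneg) auto
  then show ?thesis
    using Lc v E.cinner_self[of v] by (simp add: hnorm_def[of "euclidean_form n _"] cinner_self)
qed

section \<open>From nilpotent matrices to contractions\<close>

text \<open>The quantitative core. A vector of dimension \<open>n\<close> is the coefficient vector
  of a polynomial of degree below \<open>N\<close>, and \<open>E m\<close> represents the monomial
  \<open>m\<close>. The bound \<open>D\<close> on the degree of \<open>p\<close> is fixed while
  \<open>N\<close> stays free.\<close>

lemma (in complex_inner_product_space) op_poly_truncation_bound:
  assumes P: "\<And>n M. commuting_contractive_nilpotent_mats n d M \<Longrightarrow> mat_opnorm (mat_poly n d p M) \<le> 1"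
    and p: "p \<in> polys_in d"
    and T: "commuting_contractive_tuple H d T" and x: "x \<in> carrier H"
    and D: "\<And>m. m \<in> Poly_Mapping.keys p \<Longrightarrow> deg_in d m \<le> D" and DN: "D < N"
  shows "real (N - D) * (hnorm H (op_poly H d p T x))\<^sup>2 \<le> real N * (hnorm H x)\<^sup>2 + 1"
proof -
  define I where "I = {m. Poly_Mapping.keys m \<subseteq> {..<d} \<and> deg_in d m < N}"
  define n where "n = card I"
  obtain e :: "nat \<Rightarrow> nat \<Rightarrow>\<^sub>0 nat" and E and Z :: "nat \<Rightarrow> complex mat"
    where e: "bij_betw e {..<n} I"
    and Ee: "\<And>c. c < n \<Longrightarrow> E (e c) = unit_vec n c" and E0: "\<And>m. m \<notin> I \<Longrightarrow> E m = 0\<^sub>v n"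
    and Ec: "\<And>m. E m \<in> carrier_vec n"
    and Zc: "\<And>j. Z j \<in> carrier_mat n n"
    and ZE: "\<And>j m. j < d \<Longrightarrow> Z j *\<^sub>v E m = E (m + Poly_Mapping.single j 1)"
    and nil: "\<And>j. j < d \<Longrightarrow> nilpotent_mat (Z j)"
    and comm: "\<And>i j. i < d \<Longrightarrow> j < d \<Longrightarrow> Z i * Z j = Z j * Z i"
    and contr: "\<And>j v. j < d \<Longrightarrow> v \<in> carrier_vec n \<Longrightarrow>
      hnorm (euclidean_cspace n) (Z j *\<^sub>v v) \<le> hnorm (euclidean_cspace n) v"
    by (rule truncated_shift_matrices[OF I_def n_def]) (rule that; assumption)
  interpret Eu: complex_hilbert_space "euclidean_cspace n" by (rule complex_hilbert_space_euclidean)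
  have Tcon: "contractive H (T j)" if "j < d" for j
    using T that by (simp add: commuting_contractive_tuple_def)
  have Thom: "T j \<in> LinearCombinations.module_hom class_ring H H" if "j < d" for j
    using Tcon[OF that] by (simp add: contractive_def bounded_operator_def)
  have Tc: "T j y \<in> carrier H" if "j < d" "y \<in> carrier H" for j y
    using module_hom_in_carrier[OF Thom] that by simp
  have Tcomm: "T i (T j y) = T j (T i y)" if "i < d" "j < d" "y \<in> carrier H" for i j y
    using T that by (simp add: commuting_contractive_tuple_def)
  define t where "t m = op_monom T m d x" for m
  have tc: "t m \<in> carrier H" for m
    unfolding t_def using Tc x by (intro op_monom_closed) auto
  have tT: "t (m + Poly_Mapping.single j 1) = T j (t m)" if "j < d" for j m
    using op_monom_add_single[of d H T j x d m] Tc Tcomm that x by (simp add: t_def)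
  \<comment> \<open>For the polynomial \<open>q\<close> with coefficient vector \<open>v\<close>,
    the value \<open>L k v\<close> is to be the part of \<open>q\<close> of degree at most
    \<open>k\<close>, evaluated at \<open>T\<close> and applied to \<open>x\<close>.\<close>
  have "\<exists>f\<in>LinearCombinations.module_hom class_ring (euclidean_cspace n) H.
      \<forall>c<n. f (unit_vec n c) = (if deg_in d (e c) \<le> k then t (e c) else \<zero>\<^bsub>H\<^esub>)" for k
    by (rule ex_module_hom_euclidean[OF module_axioms]) (simp add: tc)
  then obtain L where L: "\<And>k. L k \<in> LinearCombinations.module_hom class_ring (euclidean_cspace n) H
      \<and> (\<forall>c<n. L k (unit_vec n c) = (if deg_in d (e c) \<le> k then t (e c) else \<zero>\<^bsub>H\<^esub>))"
    unfolding Bex_def by metis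
  have Lhom: "L k \<in> LinearCombinations.module_hom class_ring (euclidean_cspace n) H" for k
    using L by (rule conjunct1)
  have Lu: "L k (unit_vec n c) = (if deg_in d (e c) \<le> k then t (e c) else \<zero>\<^bsub>H\<^esub>)" if "c < n" for k c
    using conjunct2[OF L] that by blast
  have L0: "L k (0\<^sub>v n) = \<zero>\<^bsub>H\<^esub>" for k
  proof -
    have "0 \<cdot>\<^sub>v 0\<^sub>v n = (0\<^sub>v n :: complex vec)" by (intro eq_vecI) auto
    then show ?thesis
      using module_hom_class_smult[OF Lhom, of "0\<^sub>v n" k 0] module_hom_in_carrier[OF Lhom, of "0\<^sub>v n" k]
        smult_l_null by simp
  qed
  have LE: "L k (E m) = (if m \<in> I \<and> deg_in d m \<le> k then t m else \<zero>\<^bsub>H\<^esub>)" for k m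
  proof (cases "m \<in> I")
    case True
    then obtain c where "c < n" "m = e c" using e by (auto simp: bij_betw_def)
    then show ?thesis using True by (simp add: Ee Lu)
  qed (simp add: E0 L0)
  have Lc: "L k v \<in> carrier H" if "v \<in> carrier_vec n" for k v
    using module_hom_in_carrier[OF Lhom] that by simp
  \<comment> \<open>A multiple of a variable has no constant term.\<close>
  have LZ0: "L 0 (Z j *\<^sub>v v) = \<zero>\<^bsub>H\<^esub>" if j: "j < d" and v: "v \<in> carrier_vec n" for j v
  proof (rule module_hom_euclidean_eqI[OF module_axioms,
        of "\<lambda>v. L 0 (Z j *\<^sub>v v)" n "\<lambda>v. \<zero>\<^bsub>H\<^esub>", OF _ _ _ v])
    show "(\<lambda>v. L 0 (Z j *\<^sub>v v)) \<in> LinearCombinations.module_hom class_ring (euclidean_cspace n) H"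
      using Lhom mult_mat_vec_module_hom[OF Zc] by (rule module_hom_comp_class)
    show "(\<lambda>v. \<zero>\<^bsub>H\<^esub>) \<in> LinearCombinations.module_hom class_ring (euclidean_cspace n) H"
      by (intro module_hom_classI) (auto simp: smult_r_null)
    show "L 0 (Z j *\<^sub>v unit_vec n c) = \<zero>\<^bsub>H\<^esub>" if "c < n" for c
      using j that by (simp add: Ee[symmetric] ZE LE deg_in_add deg_in_single)
  qed
  \<comment> \<open>For a monomial of degree at most \<open>k\<close>, the condition
    \<open>Suc k < N\<close> keeps its product with variable \<open>j\<close> inside
    \<open>I\<close>; for a monomial of larger degree both sides are zero.\<close>
  have LZ: "L (Suc k) (Z j *\<^sub>v v) = T j (L k v)" if j: "j < d" and k: "Suc k < N" and v: "v \<in> carrier_vec n" for j k v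
  proof (rule module_hom_euclidean_eqI[OF module_axioms,
        of "\<lambda>v. L (Suc k) (Z j *\<^sub>v v)" n "\<lambda>v. T j (L k v)", OF _ _ _ v])
    show "(\<lambda>v. L (Suc k) (Z j *\<^sub>v v)) \<in> LinearCombinations.module_hom class_ring (euclidean_cspace n) H"
      using Lhom mult_mat_vec_module_hom[OF Zc] by (rule module_hom_comp_class)
    show "(\<lambda>v. T j (L k v)) \<in> LinearCombinations.module_hom class_ring (euclidean_cspace n) H"
      using Thom[OF j] Lhom by (rule module_hom_comp_class)
    have T0: "T j \<zero>\<^bsub>H\<^esub> = \<zero>\<^bsub>H\<^esub>"
      using module_hom_class_smult[OF Thom[OF j], of "\<zero>\<^bsub>H\<^esub>" 0] Tc[OF j] smult_l_null by simp
    show "L (Suc k) (Z j *\<^sub>v unit_vec n c) = T j (L k (unit_vec n c))" if c: "c < n" for c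
    proof -
      have "e c \<in> I" using c e by (auto simp: bij_betw_def)
      then have "e c + Poly_Mapping.single j 1 \<in> I" if "deg_in d (e c) \<le> k"
        using that j k by (simp add: I_def keys_add_nat deg_in_add deg_in_single)
      then show ?thesis
        using j c \<open>e c \<in> I\<close> tT[OF j, of "e c"] T0
        by (simp add: Ee[symmetric] ZE LE deg_in_add deg_in_single)
    qed
  qed
  define B where "B = (\<lambda>v w. (\<Sum>k<N. cinner H (L k v) (L k w)) + cinner (euclidean_cspace n) v w)"
  interpret B: euclidean_inner_product n B
    unfolding B_def by (rule euclidean_inner_product_pullback[OF Lhom])
  have Bnorm: "(hnorm (euclidean_form n B) v)\<^sup>2
      = (\<Sum>k<N. (hnorm H (L k v))\<^sup>2) + (hnorm (euclidean_cspace n) v)\<^sup>2" if "v \<in> carrier_vec n" for v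
    unfolding B_def by (rule hnorm_pullback[OF Lhom that])
  have Bcontr: "hnorm (euclidean_form n B) (Z j *\<^sub>v v) \<le> hnorm (euclidean_form n B) v"
    if j: "j < d" and v: "v \<in> carrier_vec n" for j v
  proof -
    obtain N' where N': "N = Suc N'" using DN by (cases N) auto
    \<comment> \<open>The term at index 0 vanishes and the others move down by one, so what is left
      is dominated by the sum for \<open>v\<close> without its last term.\<close>
    have "(\<Sum>k<N. (hnorm H (L k (Z j *\<^sub>v v)))\<^sup>2) = (\<Sum>k<N'. (hnorm H (T j (L k v)))\<^sup>2)"
      unfolding N' sum.lessThan_Suc_shift using LZ[OF j _ v] by (simp add: LZ0[OF j v] hnorm_zero N')
    also have "\<dots> \<le> (\<Sum>k<N'. (hnorm H (L k v))\<^sup>2)"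
      using contractive_hnorm_le[OF Tcon[OF j]] Lc[OF v] hnorm_nonneg[OF Tc[OF j]]
      by (intro sum_mono power_mono) auto
    also have "\<dots> \<le> (\<Sum>k<N. (hnorm H (L k v))\<^sup>2)" by (simp add: N')
    finally have "(hnorm (euclidean_form n B) (Z j *\<^sub>v v))\<^sup>2 \<le> (hnorm (euclidean_form n B) v)\<^sup>2"
      using contr[OF j v] Eu.hnorm_nonneg[of "Z j *\<^sub>v v"] Zc[of j] v
      by (simp add: Bnorm add_mono power_mono)
    then show ?thesis
      by (rule power2_le_imp_le) (use B.K.hnorm_nonneg[of v] v in simp)
  qed
  \<comment> \<open>\<open>E 0\<close> represents the constant polynomial 1, so \<open>q\<close> is
    \<open>p(Z) 1\<close>. The degree of \<open>p\<close> is below \<open>N\<close>, hence nothing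
    is truncated and \<open>q\<close> represents \<open>p\<close> itself.\<close>
  define q where "q = op_poly (euclidean_cspace n) d p (\<lambda>j. (*\<^sub>v) (Z j)) (E 0)"
  have pm: "m \<in> I" if "m \<in> Poly_Mapping.keys p" for m
    using p D[OF that] DN that by (auto simp: polys_in_def I_def)
  have q: "q = (\<Oplus>\<^bsub>euclidean_cspace n\<^esub>m\<in>Poly_Mapping.keys p. Poly_Mapping.lookup p m \<odot>\<^bsub>euclidean_cspace n\<^esub> E m)"
    unfolding q_def op_poly_def
  proof (rule Eu.M.finsum_cong')
    fix m assume "m \<in> Poly_Mapping.keys p"
    then have "op_monom (\<lambda>j. (*\<^sub>v) (Z j)) m d (E 0) = E m"
      using pm op_monom_translate[of d "\<lambda>j. (*\<^sub>v) (Z j)" E m 0] ZE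
      by (simp add: poly_mapping_eq_sum_single I_def)
    then show "Poly_Mapping.lookup p m \<odot>\<^bsub>euclidean_cspace n\<^esub> op_monom (\<lambda>j. (*\<^sub>v) (Z j)) m d (E 0)
        = Poly_Mapping.lookup p m \<odot>\<^bsub>euclidean_cspace n\<^esub> E m" by simp
  qed (auto simp: Ec)
  have qc: "q \<in> carrier_vec n"
    using Eu.M.finsum_closed[of "\<lambda>m. Poly_Mapping.lookup p m \<odot>\<^bsub>euclidean_cspace n\<^esub> E m" "Poly_Mapping.keys p"] Ec
    by (simp add: q)
  \<comment> \<open>From index \<open>D\<close> on, the part of degree at most \<open>k\<close> is
    all of \<open>p\<close>.\<close>
  have Lq: "L k q = op_poly H d p T x" if "D \<le> k" for k
  proof -
    have "L k q = (\<Oplus>\<^bsub>H\<^esub>m\<in>Poly_Mapping.keys p. L k (Poly_Mapping.lookup p m \<odot>\<^bsub>euclidean_cspace n\<^esub> E m))"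
      unfolding q using Ec by (intro module_hom_finsum[OF module_euclidean module_axioms Lhom]) auto
    also have "\<dots> = op_poly H d p T x"
      unfolding op_poly_def t_def[symmetric]
    proof (rule M.finsum_cong')
      fix m assume m: "m \<in> Poly_Mapping.keys p"
      show "L k (Poly_Mapping.lookup p m \<odot>\<^bsub>euclidean_cspace n\<^esub> E m) = Poly_Mapping.lookup p m \<odot>\<^bsub>H\<^esub> t m"
        using module_hom_class_smult[OF Lhom, of "E m" k "Poly_Mapping.lookup p m"]
          Ec pm[OF m] D[OF m] that by (simp add: LE)
    qed (use tc in auto)
    finally show ?thesis .
  qed
  have "0 \<in> I" using DN by (simp add: I_def deg_in_def)
  then obtain c where c: "c < n" "e c = 0" using e by (auto simp: bij_betw_def image_iff)
  have "op_monom T 0 k y = y" for k y by (induction k) auto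
  \<comment> \<open>The constant polynomial is unchanged by every cut-off, so each of the
    \<open>N\<close> indices contributes the norm of \<open>x\<close>; the Euclidean summand
    contributes the additional 1.\<close>
  then have LE0: "L k (E 0) = x" for k
    using \<open>0 \<in> I\<close> by (simp add: LE t_def deg_in_def)
  have "hnorm (euclidean_cspace n) (E 0) = 1"
    using Ee[OF c(1)] c by (simp add: hnorm_euclidean if_distrib[of cmod] if_distrib[of "\<lambda>r. r\<^sup>2"] cong: if_cong)
  then have norm0: "(hnorm (euclidean_form n B) (E 0))\<^sup>2 = real N * (hnorm H x)\<^sup>2 + 1"
    using Ec by (simp add: Bnorm LE0)
  \<comment> \<open>The indices from \<open>D\<close> to \<open>N - 1\<close> all give the same
    vector; the remaining ones are bounded below by zero.\<close>
  have "real (N - D) * (hnorm H (op_poly H d p T x))\<^sup>2 = (\<Sum>k\<in>{D..<N}. (hnorm H (L k q))\<^sup>2)"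
    by (simp add: Lq)
  also have "\<dots> \<le> (\<Sum>k<N. (hnorm H (L k q))\<^sup>2)"
    by (intro sum_mono2) auto
  also have "\<dots> \<le> (hnorm (euclidean_form n B) q)\<^sup>2" by (simp add: Bnorm qc)
  also have "\<dots> \<le> (hnorm (euclidean_form n B) (E 0))\<^sup>2"
    using B.nilpotent_mats_criterion[of d p Z "E 0"] P Zc nil comm Bcontr Ec
      B.K.hnorm_nonneg[of q] qc by (intro power_mono) (auto simp: q_def)
  also note norm0
  finally show ?thesis .
qed

text \<open>The truncation bound has an error that does not grow with \<open>N\<close>, so it
  disappears in the limit. The limit is taken by the Archimedean property.\<close>

lemma (in complex_inner_product_space) opnorm_op_poly_le_if_nilpotent_mats:
  assumes P: "\<And>n M. commuting_contractive_nilpotent_mats n d M \<Longrightarrow> mat_opnorm (mat_poly n d p M) \<le> 1"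
    and p: "p \<in> polys_in d" and T: "commuting_contractive_tuple H d T"
  shows "opnorm H (op_poly H d p T) \<le> 1"
proof (rule opnorm_leI)
  fix x assume x: "x \<in> carrier H"
  \<comment> \<open>Inserting 0 keeps the maximum defined when \<open>p\<close> is zero.\<close>
  define D where "D = Max (insert 0 (deg_in d ` Poly_Mapping.keys p))"
  have D: "deg_in d m \<le> D" if "m \<in> Poly_Mapping.keys p" for m
    unfolding D_def using that by (intro Max_ge) auto
  define a where "a = (hnorm H (op_poly H d p T x))\<^sup>2"
  define b where "b = (hnorm H x)\<^sup>2"
  \<comment> \<open>The truncation bound with \<open>N = D + k\<close>, rearranged so that the right
    side is free of \<open>k\<close>. The case \<open>k = 0\<close> is separate because that bound
    requires \<open>D < N\<close>.\<close>
  have "real k * (a - b) \<le> real D * b + 1" for k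
  proof (cases "k = 0")
    case False
    then show ?thesis
      using op_poly_truncation_bound[OF P p T x D, of "D + k"]
      by (simp add: a_def b_def algebra_simps)
  qed (simp add: b_def)
  \<comment> \<open>Otherwise the multiples of \<open>a - b\<close> would exceed the fixed right
    side.\<close>
  then have "a \<le> b"
    using reals_Archimedean3[of "a - b"] by (meson diff_gt_0_iff_gt not_le)
  then have "(hnorm H (op_poly H d p T x))\<^sup>2 \<le> (hnorm H x)\<^sup>2" by (simp add: a_def b_def)
  then show "hnorm H (op_poly H d p T x) \<le> hnorm H x"
    by (rule power2_le_imp_le) (rule hnorm_nonneg[OF x])
qed

theorem theorem1p1:
  fixes d :: nat and p :: "(nat \<Rightarrow>\<^sub>0 nat) \<Rightarrow>\<^sub>0 complex"
  assumes "d \<ge> 1"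
    and "p \<in> polys_in d"
    and "(UNIV :: complex set) \<lesssim> (UNIV :: 'a set)"
  shows "(\<forall>(H :: 'a cinner_space) T.
            complex_hilbert_space H \<longrightarrow> commuting_contractive_tuple H d T
              \<longrightarrow> opnorm H (op_poly H d p T) \<le> 1)
     \<longleftrightarrow> (\<forall>n M. commuting_contractive_nilpotent_mats n d M
              \<longrightarrow> mat_opnorm (mat_poly n d p M) \<le> 1)"
proof (intro iffI allI impI)
  fix n M
  assume "\<forall>(H :: 'a cinner_space) T. complex_hilbert_space H \<longrightarrow> commuting_contractive_tuple H d T
      \<longrightarrow> opnorm H (op_poly H d p T) \<le> 1"
    and "commuting_contractive_nilpotent_mats n d M"
  then show "mat_opnorm (mat_poly n d p M) \<le> 1"
    using mat_opnorm_mat_poly_le_if_hilbert[OF assms(3)] by blast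
next
  fix H :: "'a cinner_space" and T
  assume P: "\<forall>n M. commuting_contractive_nilpotent_mats n d M \<longrightarrow> mat_opnorm (mat_poly n d p M) \<le> 1"
    and H: "complex_hilbert_space H" and T: "commuting_contractive_tuple H d T"
  interpret complex_hilbert_space H by (rule H)
  show "opnorm H (op_poly H d p T) \<le> 1"
    using P by (intro opnorm_op_poly_le_if_nilpotent_mats assms(2) T) auto
qed

end
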